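(* Assume (A2), (A3), (A4), (A5), (A7), (A8) stated in the context. Then the iterates $\{x_t\}$ satisfy the $(L^p,\max\{a_t,1\}\sqrt{\eta_t})$-consistency, with $p>2$ from (A2): there exists a constant $C_p\ge1$ such that for all $t\ge0$, \[ (\mathbb E\|x_t-x^\star\|^p)^{1/p}\le C_p\max\{a_t,1\}\sqrt{\eta_t}, \] where $a_t:=0$ if $\rho=0$ and $a_t:=\lceil\log_\rho\frac{\eta_t}{\sigma\kappa}\rceil$ if $\rho\in(0,1)$ (with the convention $a_t=0$ if $\sigma=0$).
   Context: Setting. $\Xi$ is a Polish space and $\{\xi_t\}_{t\ge0}$ is a time-homogeneous Markov chain on $\Xi$ with transition kernel $P$ and stationary distribution $\pi$ (arbitrary initial distribution). For $F(x,\xi)$, $\mathcal PF(x,\xi):=\int_\Xi F(x,\xi')P(\xi,d\xi')$. $\|\cdot\|$ is a norm on $\mathbb R^d$. $H:\mathbb R^d\times\Xi\to\mathbb R^d$ measurable, $g(x):=\int H(x,\xi)\pi(d\xi)$, $g(x^\star)=0$, and $x_{t+1}=x_t-\eta_tH(x_t,\xi_t)$. (A2) There exist $p>2$ and $\sigma>0$ with $\sup_t(\mathbb E\|H(x^\star,\xi_t)\|^p)^{1/p}<\infty$ and $\sup_\xi\|\mathcal PH(x^\star,\xi)\|\le\sigma$. (A3) There is $L_H$ with $(\int\|H(x,\xi')-H(y,\xi')\|^pP(\xi,d\xi'))^{1/p}\le L_H\|x-y\|$ for all $x,y,\xi$. (A4) $\pi$ is the unique stationary distribution and $d_{TV}(P^t(\xi,\cdot),\pi)\le\kappa\rho^t/2$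 for all $\xi\in\Xi$, $t\ge0$, for some $\kappa\ge e$, $\rho\in[0,1)$. (A5) (i) $0<\eta_t\le1$, $\eta_t\downarrow0$, $\eta_t\log^2t\to0$, $t\eta_t\uparrow\infty$; (ii) $(\eta_{t-1}-\eta_t)/\eta_{t-1}=o(\eta_{t-1})$; (iii) $\sum_{t\ge1}\frac{\log t}{\sqrt t}\eta_t<\infty$; (iv) $\sum_{t=0}^T\eta_t/(T\eta_T)\le C$ for all $T\ge1$. (A7) (Contraction) There exist $\gamma\in[0,1)$ and $c>0$ such that $\|\mathcal P(H(x,\xi)-H(y,\xi))-c(x-y)\|\le\gamma c\|x-y\|$ for all $x,y\in\mathbb R^d$, $\xi\in\Xi$. (A8) (Growth) There exist $M>0$ and a nonnegative function $\bar g:\Xi\to\mathbb R$ with $\|H(x,\xi)\|\le M(\|x\|+\bar g(\xi))$ for all $x,\xi$, and $\sup_{t\ge0}\mathbb E|\bar g(\xi_t)|^p<\infty$ with $p$ from (A2). *)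

theory Defs
  imports "HOL-Probability.Probability" "HOL-Library.Landau_Symbols"
begin

definition is_norm :: "('b::euclidean_space \<Rightarrow> real) \<Rightarrow> bool" where
  "is_norm N \<longleftrightarrow> (\<forall>x. N x = 0 \<longleftrightarrow> x = 0) \<and> (\<forall>x y. N (x + y) \<le> N x + N y)
      \<and> (\<forall>c x. N (c *\<^sub>R x) = \<bar>c\<bar> * N x)"

fun kpow :: "('a::topological_space \<Rightarrow> 'a measure) \<Rightarrow> nat \<Rightarrow> 'a \<Rightarrow> 'a measure" where
  "kpow K 0 \<xi> = return borel \<xi>"
| "kpow K (Suc n) \<xi> = bind (K \<xi>) (kpow K n)"

definition dtv :: "'a::topological_space measure \<Rightarrow> 'a measure \<Rightarrow> real" where
  "dtv \<mu> \<nu> = (SUP A \<in> sets borel. \<bar>measure \<mu> A - measure \<nu> A\<bar>)"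

definition stationary :: "('a::topological_space \<Rightarrow> 'a measure) \<Rightarrow> 'a measure \<Rightarrow> bool" where
  "stationary K \<pi> \<longleftrightarrow> prob_space \<pi> \<and> sets \<pi> = sets borel \<and>
     (\<forall>B \<in> sets borel. (\<integral>\<xi>. measure (K \<xi>) B \<partial>\<pi>) = measure \<pi> B)"

definition hist :: "'w measure \<Rightarrow> (nat \<Rightarrow> 'w \<Rightarrow> 'a::topological_space) \<Rightarrow> nat \<Rightarrow> 'w set set" where
  "hist M \<xi> t = sigma_sets (space M) (\<Union>i\<le>t. {\<xi> i -` B \<inter> space M | B. B \<in> sets borel})"

definition markov_chain :: "'w measure \<Rightarrow> (nat \<Rightarrow> 'w \<Rightarrow> 'a::topological_space) \<Rightarrow> ('a \<Rightarrow> 'a measure) \<Rightarrow> bool" where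
  "markov_chain M \<xi> K \<longleftrightarrow> prob_space M \<and> K \<in> measurable borel (prob_algebra borel) \<and>
     (\<forall>t. \<xi> t \<in> measurable M borel) \<and>
     (\<forall>t. \<forall>A \<in> hist M \<xi> t. \<forall>B \<in> sets borel.
        measure M (A \<inter> (\<xi> (Suc t) -` B \<inter> space M)) = (\<integral>\<omega>. indicator A \<omega> * measure (K (\<xi> t \<omega>)) B \<partial>M))"

primrec sa_iter :: "('b::real_vector \<Rightarrow> 'a \<Rightarrow> 'b) \<Rightarrow> (nat \<Rightarrow> real) \<Rightarrow> (nat \<Rightarrow> 'w \<Rightarrow> 'a) \<Rightarrow> 'b \<Rightarrow> nat \<Rightarrow> 'w \<Rightarrow> 'b" where
  "sa_iter H \<eta> \<xi> x0 0 \<omega> = x0"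
| "sa_iter H \<eta> \<xi> x0 (Suc t) \<omega> = sa_iter H \<eta> \<xi> x0 t \<omega> - \<eta> t *\<^sub>R H (sa_iter H \<eta> \<xi> x0 t \<omega>) (\<xi> t \<omega>)"

definition a_seq :: "real \<Rightarrow> real \<Rightarrow> real \<Rightarrow> (nat \<Rightarrow> real) \<Rightarrow> nat \<Rightarrow> real" where
  "a_seq \<rho> \<sigma> \<kappa> \<eta> t = (if \<rho> = 0 \<or> \<sigma> = 0 then 0
      else real_of_int \<lceil>log \<rho> (\<eta> t / (\<sigma> * \<kappa>))\<rceil>)"

end

theory Submission
  imports Defs
begin

text \<open>
  Write \<open>b z = \<integral>H xs dK z\<close>. This function is bounded and has \<open>\<pi>\<close>-mean zero, so by geometric ergodicity the
  Poisson equation \<open>h - K h = b\<close> has a bounded solution \<open>h\<close>. It turns the Markovian bias \<open>b (\<xi> n)\<close> into a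
  bounded martingale difference plus the telescoping term \<open>h (\<xi> n) - h (\<xi> (n + 1))\<close>.

  Since \<open>N\<close> need not be smooth, the error \<open>x - xs\<close> is split into a linear recursion \<open>u\<close> driven by the
  martingale differences and a remainder \<open>w\<close>, up to \<open>\<eta> h\<close>. The part \<open>u\<close> is measured in the Euclidean norm,
  where \<open>|a + b|^p \<le> |a|^p + p |a|^(p-2) (a \<bullet> b) + C (|a|^(p-2) |b|^2 + |b|^p)\<close> makes the first-order
  term vanish in conditional mean. The part \<open>w\<close> contracts in \<open>N\<close> pathwise. The moment
  \<open>E (A |u|^p + N w ^ p)\<close> then satisfies \<open>Z' \<le> (1 - \<mu> \<eta>) Z + C \<eta> ^ (p/2 + 1)\<close>, and as
  \<open>\<eta> n - \<eta> (n + 1) = o((\<eta> n)^2)\<close> this forces \<open>Z = O(\<eta> ^ (p/2))\<close>, with no mixing-time factor.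
\<close>

section \<open>Power inequalities\<close>

text \<open>Two requirements conflict. Contraction is available only in \<open>N\<close>, while
  cancelling the martingale term needs a smooth norm, and passing between norms at every step would
  cost a constant that destroys a factor such as \<open>1 - c * \<eta>\<close>. Since
  \<open>u\<close> has drift exactly \<open>c\<close>, the recursion of \<open>w\<close> contains
  \<open>PH x - PH xs - c (x - xs)\<close>, the expression controlled by (A7).

  The exponent \<open>p/2 + 1\<close> comes from balancing
  \<open>|u|^(p-2) \<eta>^2 |noise|^2\<close> against the decay term \<open>\<eta> |u|^p\<close>;
  division by the decay rate \<open>\<eta>\<close> leaves \<open>p/2\<close>. The noise grows with
  the iterate, so the moment of \<open>x\<close> feeds back into that of \<open>u\<close>, but only
  with a factor \<open>\<eta>^(p/2 + 1)\<close>. As \<open>p > 2\<close>, this factor is at most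
  \<open>\<eta>^2\<close> and is absorbed once the steps are small. The splitting is therefore
  started with \<open>u = 0\<close> at a late index \<open>n0\<close>; up to that time finiteness of
  the moments is enough.\<close>

lemma powr_add_le:
  fixes x y p :: real
  assumes "0 \<le> x" "0 \<le> y" "0 \<le> p"
  shows "(x + y) powr p \<le> 2 powr p * (x powr p + y powr p)"
proof -
  have "(x + y) powr p \<le> (2 * max x y) powr p"
    using assms by (intro powr_mono2) auto
  also have "\<dots> = 2 powr p * max x y powr p"
    using assms by (simp add: powr_mult)
  also have "\<dots> \<le> 2 powr p * (x powr p + y powr p)"
    by (intro mult_left_mono) (auto simp: max_def)
  finally show ?thesis .
qed

text \<open>Exponents of either sign occur (\<open>q - 2\<close> with \<open>q\<close> close to 1),
  so the range must stay away from 0; it is symmetric under inversion, which reduces negative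
  exponents to positive ones.\<close>

lemma powr_sandwich:
  fixes x r :: real
  assumes "1/4 \<le> x" "x \<le> 4"
  shows "x powr r \<le> 4 powr \<bar>r\<bar>"
proof (cases "r \<ge> 0")
  case True
  then show ?thesis using assms by (auto intro!: powr_mono2)
next
  case False
  have "x powr r = (1 / x) powr (- r)"
    using assms by (simp add: powr_divide powr_minus_divide)
  also have "\<dots> \<le> 4 powr (- r)"
    using False assms by (intro powr_mono2) (auto simp: field_simps)
  finally show ?thesis using False by simp
qed

text \<open>The mean value theorem with base point 1. The intermediate point is kept within the same
  interval and at most as far from 1 as \<open>x\<close>, so that the lemma can be applied again to
  it.\<close>

lemma powr_diff_mvt:
  fixes x r :: real
  assumes "1/4 \<le> x" "x \<le> 4"
  shows "\<exists>z. \<bar>z - 1\<bar> \<le> \<bar>x - 1\<bar> \<and> 1/4 \<le> z \<and> z \<le> 4 \<and> x powr r - 1 = (x - 1) * (r * z powr (r - 1))"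
proof -
  have d: "((\<lambda>y. y powr r) has_real_derivative r * y powr (r - 1)) (at y)" if "y > 0" for y
    using that by (rule has_real_derivative_powr)
  consider "x = 1" | "x < 1" | "x > 1" by linarith
  then show ?thesis
  proof cases
    case 1
    then show ?thesis by (intro exI[of _ 1]) auto
  next
    case 2
    then obtain z where "x < z" "z < 1" "1 powr r - x powr r = (1 - x) * (r * z powr (r - 1))"
      using MVT2[of x 1 "\<lambda>y. y powr r" "\<lambda>y. r * y powr (r - 1)"] d assms by auto
    then show ?thesis using assms by (intro exI[of _ z]) (auto simp: algebra_simps)
  next
    case 3
    then obtain z where "1 < z" "z < x" "x powr r - 1 powr r = (x - 1) * (r * z powr (r - 1))"
      using MVT2[of 1 x "\<lambda>y. y powr r" "\<lambda>y. r * y powr (r - 1)"] d assms by auto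
    then show ?thesis using assms by (intro exI[of _ z]) (auto simp: algebra_simps)
  qed
qed

text \<open>Two applications of the mean value theorem: the first yields \<open>z\<close> with
  \<open>z - 1\<close> bounded by \<open>\<theta>\<close>, the second expands the derivative
  \<open>z powr (q - 1)\<close> around 1. The bound 3/4 keeps \<open>1 + \<theta>\<close> above
  1/4.\<close>

lemma powr_taylor2:
  fixes q :: real
  assumes "1 \<le> q"
  obtains C where "0 \<le> C"
    "\<And>\<theta>. \<bar>\<theta>\<bar> \<le> 3/4 \<Longrightarrow> (1 + \<theta>) powr q \<le> 1 + q * \<theta> + C * \<theta>\<^sup>2"
proof
  let ?C = "q * (q - 1) * 4 powr \<bar>q - 2\<bar>"
  show "0 \<le> ?C" using assms by simp
  fix \<theta> :: real assume \<theta>: "\<bar>\<theta>\<bar> \<le> 3/4"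
  obtain z where z: "\<bar>z - 1\<bar> \<le> \<bar>\<theta>\<bar>" "1/4 \<le> z" "z \<le> 4"
    "(1 + \<theta>) powr q - 1 = \<theta> * (q * z powr (q - 1))"
    using powr_diff_mvt[of "1 + \<theta>" q] \<theta> unfolding abs_le_iff by auto
  obtain y where y: "1/4 \<le> y" "y \<le> 4" "z powr (q - 1) - 1 = (z - 1) * ((q - 1) * y powr (q - 2))"
    using powr_diff_mvt[of z "q - 1"] z by auto
  have "(1 + \<theta>) powr q - 1 - q * \<theta> = \<theta> * (q * (z powr (q - 1) - 1))"
    unfolding z(4) by (simp add: algebra_simps)
  also have "\<dots> = (\<theta> * (z - 1)) * (q * (q - 1) * y powr (q - 2))"
    unfolding y(3) by (simp add: algebra_simps)
  also have "\<dots> \<le> (\<bar>\<theta>\<bar> * \<bar>z - 1\<bar>) * (q * (q - 1) * y powr (q - 2))"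
    using assms by (intro mult_right_mono) (auto simp flip: abs_mult)
  also have "\<dots> \<le> (\<bar>\<theta>\<bar> * \<bar>\<theta>\<bar>) * ?C"
    using assms z y powr_sandwich[of y "q - 2"] by (intro mult_mono mult_left_mono) auto
  finally show "(1 + \<theta>) powr q \<le> 1 + q * \<theta> + ?C * \<theta>\<^sup>2"
    by (simp add: power2_eq_square algebra_simps)
qed

text \<open>Two regimes. If \<open>b\<close> is small relative to \<open>a\<close>, expand
  \<open>(|a|^2 + h)^q\<close> with \<open>q = p/2\<close>, where \<open>h\<close> is the increment
  of the squared norm. Otherwise \<open>|a|\<close> is at most \<open>4 |b|\<close>, and every term,
  including a negative first-order one, is dominated by \<open>|b|^p\<close>.\<close>

lemma norm_add_powr_le:
  fixes p :: real
  assumes p: "p > 2"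
  obtains C where "0 \<le> C"
    "\<And>a b::'b::real_inner. norm (a + b) powr p \<le> norm a powr p + p * norm a powr (p - 2) * (a \<bullet> b)
       + C * (norm a powr (p - 2) * (norm b)\<^sup>2 + norm b powr p)"
proof -
  define q where "q = p / 2"
  have q: "q > 1" "p = 2 * q" using p by (auto simp: q_def)
  obtain C where C: "0 \<le> C" "\<And>\<theta>. \<bar>\<theta>\<bar> \<le> 3/4 \<Longrightarrow> (1 + \<theta>) powr q \<le> 1 + q * \<theta> + C * \<theta>\<^sup>2"
    using powr_taylor2[of q] q by auto
  \<comment> \<open>The first entry serves small \<open>b\<close>: \<open>q\<close> comes from the
    \<open>|b|^2\<close> inside \<open>h\<close>, and \<open>9 * C\<close> from
    \<open>|h| <= 3 |a| |b|\<close>. The second serves large \<open>b\<close>: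
    \<open>5 powr p\<close> bounds \<open>|a + b|^p\<close>, and the rest bounds the first-order
    term.\<close>
  define D where "D = max (q + 9 * C) (5 powr p + p * 4 powr (p - 1))"
  show thesis
  proof
    show "0 \<le> D" using C q by (auto simp: D_def le_max_iff_disj)
    fix a b :: 'b
    have hs: "(norm (a + b))\<^sup>2 = (norm a)\<^sup>2 + (2 * (a \<bullet> b) + (norm b)\<^sup>2)"
      by (simp add: power2_norm_eq_inner algebra_simps inner_commute)
    have cs: "\<bar>a \<bullet> b\<bar> \<le> norm a * norm b" by (rule Cauchy_Schwarz_ineq2)
    show "norm (a + b) powr p \<le> norm a powr p + p * norm a powr (p - 2) * (a \<bullet> b)
       + D * (norm a powr (p - 2) * (norm b)\<^sup>2 + norm b powr p)"
    \<comment> \<open>The threshold 1/4 makes \<open>|h| <= 3 |a| |b|\<close> at most 3/4 of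
      \<open>|a|^2\<close>, the range of the Taylor estimate.\<close>
    proof (cases "norm b < norm a / 4")
      case True
      define s where "s = (norm a)\<^sup>2"
      define h where "h = 2 * (a \<bullet> b) + (norm b)\<^sup>2"
      have na: "norm a > 0" using True norm_ge_zero[of b] by linarith
      then have s: "s > 0" by (simp add: s_def)
      have sr: "s powr r = norm a powr (2 * r)" for r
        using na unfolding s_def by (simp add: powr_powr flip: powr_numeral)
      have nb: "(norm b)\<^sup>2 \<le> norm a * norm b / 4"
        using True na mult_right_mono[of "norm b" "norm a / 4" "norm b"] by (simp add: power2_eq_square)
      have h1: "\<bar>h\<bar> \<le> 3 * (norm a * norm b)"
        unfolding h_def using cs nb zero_le_power2[of "norm b"] mult_nonneg_nonneg[of "norm a" "norm b"] by linarith
      have h2: "\<bar>h\<bar> \<le> 3/4 * s"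
      proof -
        have "norm a * norm b \<le> norm a * (norm a / 4)" using True na by (intro mult_left_mono) auto
        then show ?thesis using h1 by (simp add: s_def power2_eq_square)
      qed
      have "norm (a + b) powr p = (s + h) powr q"
        unfolding s_def h_def hs[symmetric] q(2)
        by (cases "norm (a + b) = 0") (simp_all add: powr_powr flip: powr_numeral)
      also have "\<dots> = s powr q * (1 + h / s) powr q"
      proof -
        have "s + h = s * (1 + h / s)" using s by (simp add: field_simps)
        moreover have "0 \<le> 1 + h / s" using h2 s by (simp add: field_simps)
        ultimately show ?thesis using s by (simp add: powr_mult)
      qed
      also have "\<dots> \<le> s powr q * (1 + q * (h / s) + C * (h / s)\<^sup>2)"
        using h2 s by (intro mult_left_mono C(2)) (auto simp: abs_divide field_simps)
      also have "\<dots> = s powr q + q * s powr (q - 1) * h + C * s powr (q - 1) * (h\<^sup>2 / s)"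
        using s by (simp add: powr_diff field_simps power2_eq_square)
      also have "\<dots> \<le> s powr q + q * s powr (q - 1) * h + C * s powr (q - 1) * (9 * (norm b)\<^sup>2)"
      proof -
        have "h\<^sup>2 \<le> (3 * (norm a * norm b))\<^sup>2" using h1 by (metis abs_ge_zero power2_abs power_mono)
        also have "\<dots> = s * (9 * (norm b)\<^sup>2)" by (simp add: s_def power2_eq_square)
        finally have "h\<^sup>2 / s \<le> 9 * (norm b)\<^sup>2" using s by (simp add: field_simps)
        then show ?thesis using C by (intro add_left_mono mult_left_mono) auto
      qed
      also have "\<dots> = norm a powr p + p * norm a powr (p - 2) * (a \<bullet> b)
         + (q + 9 * C) * (norm a powr (p - 2) * (norm b)\<^sup>2)"
        unfolding sr h_def by (simp add: q(2) algebra_simps)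
      also have "\<dots> \<le> norm a powr p + p * norm a powr (p - 2) * (a \<bullet> b)
         + D * (norm a powr (p - 2) * (norm b)\<^sup>2 + norm b powr p)"
        using C q by (intro add_left_mono mult_mono) (auto simp: D_def)
      finally show ?thesis .
    next
      case False
      then have ab: "norm a \<le> 4 * norm b" by simp
      have "norm (a + b) powr p \<le> (5 * norm b) powr p"
        using ab norm_triangle_ineq[of a b] p by (intro powr_mono2) auto
      then have 1: "norm (a + b) powr p \<le> 5 powr p * norm b powr p"
        by (simp add: powr_mult)
      have "- (norm a powr (p - 2) * (a \<bullet> b)) = norm a powr (p - 2) * (- (a \<bullet> b))" by simp
      also have "\<dots> \<le> norm a powr (p - 2) * (norm a * norm b)"
        using cs by (intro mult_left_mono) auto
      also have "\<dots> = norm a powr (p - 1) * norm b"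
        by (cases "norm a = 0") (auto simp: powr_diff power2_eq_square)
      also have "\<dots> \<le> (4 * norm b) powr (p - 1) * norm b"
        using ab p by (intro mult_right_mono powr_mono2) auto
      also have "\<dots> = 4 powr (p - 1) * norm b powr p"
        by (cases "norm b = 0") (auto simp: powr_diff powr_mult)
      finally have "p * - (norm a powr (p - 2) * (a \<bullet> b)) \<le> p * (4 powr (p - 1) * norm b powr p)"
        using p by (intro mult_left_mono) auto
      then have 2: "- (p * norm a powr (p - 2) * (a \<bullet> b)) \<le> p * 4 powr (p - 1) * norm b powr p"
        by (simp add: mult.assoc)
      have "norm (a + b) powr p \<le> p * norm a powr (p - 2) * (a \<bullet> b)
          + (5 powr p + p * 4 powr (p - 1)) * norm b powr p"
        using 1 2 by (simp add: algebra_simps)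
      also have "\<dots> \<le> p * norm a powr (p - 2) * (a \<bullet> b)
          + D * (norm a powr (p - 2) * (norm b)\<^sup>2 + norm b powr p)"
        using p by (intro add_left_mono mult_mono) (auto simp: D_def le_max_iff_disj)
      also have "\<dots> \<le> norm a powr p + p * norm a powr (p - 2) * (a \<bullet> b)
          + D * (norm a powr (p - 2) * (norm b)\<^sup>2 + norm b powr p)" by simp
      finally show ?thesis .
    qed
  qed
qed

text \<open>Young's inequality arranged so that \<open>x powr p\<close> keeps exactly one factor
  \<open>\<eta>\<close>, with an arbitrarily small coefficient, and can later be absorbed by a
  contraction of order \<open>\<eta>\<close>. The case split compares \<open>\<eta> * y^2\<close>
  with \<open>\<epsilon> * x^2\<close>.\<close>

lemma young_step_size:
  fixes x y \<eta> \<epsilon> p :: real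
  assumes p: "p > 2" and "0 < \<epsilon>" "0 < \<eta>" "0 \<le> x" "0 \<le> y"
  shows "x powr (p - 2) * (\<eta> * y)\<^sup>2
     \<le> \<epsilon> * \<eta> * x powr p + \<epsilon> powr (1 - p / 2) * \<eta> powr (p / 2 + 1) * y powr p"
proof (cases "\<eta> * y\<^sup>2 \<le> \<epsilon> * x\<^sup>2")
  case True
  have "x powr (p - 2) * (\<eta> * y)\<^sup>2 = \<eta> * x powr (p - 2) * (\<eta> * y\<^sup>2)"
    by (simp add: power2_eq_square)
  also have "\<dots> \<le> \<eta> * x powr (p - 2) * (\<epsilon> * x\<^sup>2)"
    using True assms by (intro mult_left_mono) auto
  also have "\<dots> = \<epsilon> * \<eta> * x powr p"
    using assms by (cases "x = 0") (auto simp: powr_diff)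
  finally show ?thesis
    using assms by (simp add: add_increasing2)
next
  case False
  define q where "q = p / 2"
  have q: "q > 1" "p = 2 * q" using p by (auto simp: q_def)
  have y: "y > 0" using False assms by (cases "y = 0") auto
  have sq: "v powr (2 * r) = (v\<^sup>2) powr r" if "v \<ge> 0" for v r :: real
    using that by (cases "v = 0") (simp_all add: powr_powr flip: powr_numeral)
  have "x powr (p - 2) = (x\<^sup>2) powr (q - 1)"
    using sq[of x "q - 1"] assms by (simp add: q(2) algebra_simps)
  also have "\<dots> \<le> (\<eta> * y\<^sup>2 / \<epsilon>) powr (q - 1)"
    using False assms q by (intro powr_mono2) (auto simp: field_simps)
  also have "\<dots> = \<epsilon> powr (1 - q) * \<eta> powr (q - 1) * y powr (2 * (q - 1))"
  proof -
    have "\<epsilon> powr (1 - q) = 1 / \<epsilon> powr (q - 1)"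
      by (metis minus_diff_eq powr_minus_divide)
    then show ?thesis
      using assms y unfolding sq[OF assms(5)] by (simp add: powr_mult powr_divide)
  qed
  finally have "x powr (p - 2) * (\<eta> * y)\<^sup>2 \<le>
      (\<epsilon> powr (1 - q) * \<eta> powr (q - 1) * y powr (2 * (q - 1))) * (\<eta> * y)\<^sup>2"
    by (intro mult_right_mono) auto
  also have "\<dots> = \<epsilon> powr (1 - q) * (\<eta> powr (q - 1) * \<eta> powr 2) * (y powr (2 * (q - 1)) * y powr 2)"
    using assms y by (simp add: power2_eq_square)
  also have "\<dots> = \<epsilon> powr (1 - q) * \<eta> powr (q + 1) * y powr p"
    unfolding powr_add[symmetric] by (simp add: q(2) add.commute)
  finally show ?thesis
    using assms by (simp add: q_def add_increasing)
qed

text \<open>Convexity keeps the factor \<open>1 - \<theta>\<close> on \<open>x powr p\<close>,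
  whereas \<open>powr_add_le\<close> would lose \<open>2 powr p\<close> and with it the contraction.
  Convexity is invoked only for positive arguments; if one vanishes, \<open>r powr p <= r\<close> on
  [0, 1] suffices.\<close>

lemma powr_convex_combination:
  fixes x y \<theta> p :: real
  assumes p: "1 \<le> p" and \<theta>: "0 \<le> \<theta>" "\<theta> \<le> 1" and xy: "0 \<le> x" "0 \<le> y"
  shows "((1 - \<theta>) * x + \<theta> * y) powr p \<le> (1 - \<theta>) * x powr p + \<theta> * y powr p"
proof -
  have shrink: "(r * z) powr p \<le> r * z powr p" if "0 \<le> r" "r \<le> 1" "0 \<le> z" for r z :: real
  proof -
    have "r powr p \<le> r powr 1" using that p by (intro powr_mono') auto
    then show ?thesis using that by (simp add: powr_mult mult_right_mono)
  qed
  consider "x = 0" | "y = 0" | "x > 0" "y > 0" using xy by linarith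
  then show ?thesis
  proof cases
    case 3
    then show ?thesis
      using convex_onD[OF powr_convex[OF p], of \<theta> x y] \<theta> by simp
  qed (use shrink[of \<theta> y] shrink[of "1 - \<theta>" x] \<theta> xy p in auto)
qed

text \<open>Bernoulli's inequality for a real exponent, from the mean value theorem and
  \<open>z powr (q - 1) <= 1\<close>. It will bound the ratio of consecutive step sizes, raised to
  the power \<open>q\<close>, from below.\<close>

lemma powr_bernoulli:
  fixes y q :: real
  assumes "0 < y" "y \<le> 1" "1 \<le> q"
  shows "1 - q * (1 - y) \<le> y powr q"
proof (cases "y = 1")
  case False
  have "\<exists>z>y. z < 1 \<and> 1 powr q - y powr q = (1 - y) * (q * z powr (q - 1))"
    using assms False by (intro MVT2 has_real_derivative_powr) auto
  then obtain z where z: "y < z" "z < 1" "1 - y powr q = (1 - y) * (q * z powr (q - 1))" by auto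
  have "z powr (q - 1) \<le> 1" using z assms powr_le1[of "q - 1" z] by auto
  have "1 - y powr q = (1 - y) * (q * z powr (q - 1))" by (rule z)
  also have "\<dots> \<le> (1 - y) * (q * 1)"
    using assms \<open>z powr (q - 1) \<le> 1\<close> by (intro mult_left_mono) auto
  finally show ?thesis by (simp add: algebra_simps)
qed simp

text \<open>Here \<open>x\<close> and \<open>y\<close> stand for consecutive step sizes, and
  \<open>B * \<eta> powr q\<close> is shown to be a supersolution of the moment recursion. Half of
  the contraction \<open>\<mu> * y\<close> pays for the decrease of the step size, the other half
  absorbs the forcing term because \<open>2 * C <= \<mu> * B\<close>.\<close>

lemma step_size_recursion:
  fixes x y q \<mu> C B \<delta> :: real
  assumes q: "1 \<le> q" and y: "0 < y" "y \<le> x" "x \<le> 2 * y" "x - y \<le> \<delta> * x\<^sup>2"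
    and \<mu>: "4 * q * \<delta> \<le> \<mu>" and C: "2 * C \<le> \<mu> * B" "0 \<le> C" "0 \<le> B" and \<delta>: "0 \<le> \<delta>"
  shows "(1 - \<mu> * y) * (B * x powr q) + C * y powr (q + 1) \<le> B * y powr q"
proof -
  define r where "r = y / x"
  have x: "x > 0" using y by linarith
  have r: "0 < r" "r \<le> 1" "y = r * x" using x y by (auto simp: r_def)
  have "1 - r \<le> \<delta> * x" using y(4) x by (simp add: r_def field_simps power2_eq_square)
  also have "\<dots> \<le> \<delta> * (2 * y)" using y \<delta> by (intro mult_left_mono)
  finally have "q * (1 - r) \<le> q * (\<delta> * (2 * y))" using q by (intro mult_left_mono) auto
  also have "\<dots> = (4 * q * \<delta>) * (y / 2)" by simp
  also have "\<dots> \<le> \<mu> * (y / 2)" using \<mu> y by (intro mult_right_mono) auto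
  finally have rq: "1 - \<mu> * y / 2 \<le> r powr q" using powr_bernoulli[OF r(1,2) q] by simp
  have rq1: "r powr q \<le> 1" using r q powr_le1[of q r] by auto
  have "C * y * r powr q \<le> C * y * 1" using C y rq1 by (intro mult_left_mono) auto
  also have "\<dots> \<le> \<mu> * B / 2 * y" using C y by simp
  finally have "(1 - \<mu> * y) * B + C * y * r powr q \<le> B * (1 - \<mu> * y / 2)" by (simp add: algebra_simps)
  also have "\<dots> \<le> B * r powr q" using rq C by (intro mult_left_mono) auto
  finally have *: "((1 - \<mu> * y) * B + C * y * r powr q) * x powr q \<le> (B * r powr q) * x powr q"
    by (intro mult_right_mono) auto
  have yq: "y powr q = r powr q * x powr q" using r x by (simp add: powr_mult)
  have yq1: "y powr (q + 1) = y * (r powr q * x powr q)"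
    using y yq by (simp add: powr_add)
  have "(1 - \<mu> * y) * (B * x powr q) + C * y powr (q + 1)
      = ((1 - \<mu> * y) * B + C * y * r powr q) * x powr q"
    unfolding yq1 by (simp add: algebra_simps)
  also note *
  also have "(B * r powr q) * x powr q = B * y powr q" unfolding yq by simp
  finally show ?thesis .
qed

section \<open>Norms and moments\<close>

text \<open>The integrand also depends on the parameter. Pushing \<open>K x\<close> forward along
  \<open>Pair x\<close> turns it into one fixed function on the product, integrated against a
  measurable kernel.\<close>

lemma integral_kernel_measurable:
  fixes f :: "'c \<Rightarrow> 'a \<Rightarrow> 'b::{banach, second_countable_topology}"
  assumes f[measurable]: "(\<lambda>(x, y). f x y) \<in> borel_measurable (L \<Otimes>\<^sub>M S)"
    and K: "K \<in> L \<rightarrow>\<^sub>M subprob_algebra S"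
  shows "(\<lambda>x. \<integral>y. f x y \<partial>K x) \<in> borel_measurable L"
proof -
  have "(\<lambda>x. distr (K x) (L \<Otimes>\<^sub>M S) (Pair x)) \<in> L \<rightarrow>\<^sub>M subprob_algebra (L \<Otimes>\<^sub>M S)"
    by (rule measurable_distr2[OF _ K]) simp
  from measurable_compose[OF this integral_measurable_subprob_algebra[OF f]]
  have "(\<lambda>x. \<integral>z. (case z of (x, y) \<Rightarrow> f x y) \<partial>distr (K x) (L \<Otimes>\<^sub>M S) (Pair x)) \<in> borel_measurable L" .
  then show "(\<lambda>x. \<integral>y. f x y \<partial>K x) \<in> borel_measurable L"
  proof (rule measurable_cong[THEN iffD1, rotated])
    fix x assume x: "x \<in> space L"
    have "Pair x \<in> K x \<rightarrow>\<^sub>M L \<Otimes>\<^sub>M S"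
      using measurable_Pair1'[OF x] by (simp add: measurable_cong_sets[OF subprob_measurableD(2)[OF K x] refl])
    from integral_distr[OF this f]
    show "(\<integral>z. (case z of (x, y) \<Rightarrow> f x y) \<partial>distr (K x) (L \<Otimes>\<^sub>M S) (Pair x)) = (\<integral>y. f x y \<partial>K x)"
      by (simp only: prod.case)
  qed
qed

lemma nn_integral_powr_add_le:
  assumes [measurable]: "f \<in> borel_measurable Q" "g \<in> borel_measurable Q"
    and "\<And>\<omega>. 0 \<le> f \<omega>" "\<And>\<omega>. 0 \<le> g \<omega>" "0 \<le> p"
  shows "(\<integral>\<^sup>+\<omega>. ennreal ((f \<omega> + g \<omega>) powr p) \<partial>Q)
    \<le> ennreal (2 powr p) * ((\<integral>\<^sup>+\<omega>. ennreal (f \<omega> powr p) \<partial>Q) + (\<integral>\<^sup>+\<omega>. ennreal (g \<omega> powr p) \<partial>Q))"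
proof -
  have "(\<integral>\<^sup>+\<omega>. ennreal ((f \<omega> + g \<omega>) powr p) \<partial>Q)
      \<le> (\<integral>\<^sup>+\<omega>. ennreal (2 powr p) * (ennreal (f \<omega> powr p) + ennreal (g \<omega> powr p)) \<partial>Q)"
    using assms by (intro nn_integral_mono)
      (auto simp: powr_add_le simp flip: ennreal_plus ennreal_mult intro!: ennreal_leI)
  also have "\<dots> = ennreal (2 powr p) * ((\<integral>\<^sup>+\<omega>. ennreal (f \<omega> powr p) \<partial>Q) + (\<integral>\<^sup>+\<omega>. ennreal (g \<omega> powr p) \<partial>Q))"
    by (simp add: nn_integral_cmult nn_integral_add)
  finally show ?thesis .
qed

text \<open>One conditional step: \<open>Q\<close> will be the transition law given the past and
  \<open>m\<close> a martingale difference, so the inner product with \<open>a\<close> integrates to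
  zero. The constant is uniform in \<open>Q\<close>, \<open>m\<close>, \<open>a\<close> and
  \<open>\<eta>\<close>, which allows integration over the past afterwards.\<close>

lemma nn_integral_norm_powr_step:
  fixes p \<epsilon> :: real
  assumes p: "p > 2" and eps: "0 < \<epsilon>"
  obtains C where "0 < C"
    "\<And>(Q :: 'a measure) (m :: 'a \<Rightarrow> 'b::euclidean_space) a \<eta>.
      \<lbrakk>prob_space Q; integrable Q m; (\<integral>z. m z \<partial>Q) = 0; 0 < \<eta>; \<eta> \<le> 1\<rbrakk> \<Longrightarrow>
      (\<integral>\<^sup>+z. ennreal (norm (a - \<eta> *\<^sub>R m z) powr p) \<partial>Q)
        \<le> ennreal ((1 + \<epsilon> * \<eta>) * norm a powr p)
          + ennreal (C * \<eta> powr (p / 2 + 1)) * (\<integral>\<^sup>+z. ennreal (norm (m z) powr p) \<partial>Q)"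
proof -
  obtain C0 where C0: "0 \<le> C0"
    "\<And>a b::'b. norm (a + b) powr p \<le> norm a powr p + p * norm a powr (p - 2) * (a \<bullet> b)
       + C0 * (norm a powr (p - 2) * (norm b)\<^sup>2 + norm b powr p)"
    using norm_add_powr_le[OF p, where 'b='b] by metis
  define \<delta> where "\<delta> = \<epsilon> / (C0 + 1)"
  have \<delta>: "\<delta> > 0" "C0 * \<delta> \<le> \<epsilon>" using eps C0 by (auto simp: \<delta>_def field_simps)
  \<comment> \<open>The summand 1 in \<open>C0 + 1\<close> makes \<open>C\<close> strictly positive,
    so that the right-hand side is infinite whenever the moment of \<open>m\<close> is; the
    remaining \<open>+ 1\<close> covers the term \<open>|b|^p\<close>.\<close>
  define C where "C = (C0 + 1) * (\<delta> powr (1 - p / 2) + 1)"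
  have Cpos: "C > 0" using C0(1) \<delta> by (auto simp: C_def intro!: mult_pos_pos add_nonneg_pos)
  have pt: "norm (a - \<eta> *\<^sub>R b) powr p \<le> (1 + \<epsilon> * \<eta>) * norm a powr p
      - \<eta> * p * norm a powr (p - 2) * (a \<bullet> b) + C * \<eta> powr (p / 2 + 1) * norm b powr p"
    if \<eta>: "0 < \<eta>" "\<eta> \<le> 1" for a b :: 'b and \<eta> :: real
  proof -
    let ?q = "\<eta> powr (p / 2 + 1) * norm b powr p"
    have "\<eta> powr p \<le> \<eta> powr (p / 2 + 1)"
      using \<eta> p by (intro powr_mono') auto
    then have "(\<eta> * norm b) powr p \<le> ?q"
      using \<eta> by (simp add: powr_mult mult_right_mono)
    moreover have "norm a powr (p - 2) * (\<eta> * norm b)\<^sup>2 \<le> \<delta> * \<eta> * norm a powr p + \<delta> powr (1 - p / 2) * ?q"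
      using young_step_size[OF p \<delta>(1) \<eta>(1), of "norm a" "norm b"] by (simp add: mult.assoc)
    ultimately have "C0 * (norm a powr (p - 2) * (\<eta> * norm b)\<^sup>2 + (\<eta> * norm b) powr p)
        \<le> C0 * ((\<delta> * \<eta> * norm a powr p + \<delta> powr (1 - p / 2) * ?q) + ?q)"
      using C0 by (intro mult_left_mono) auto
    also have "\<dots> = C0 * \<delta> * (\<eta> * norm a powr p) + C0 * (\<delta> powr (1 - p / 2) + 1) * ?q"
      by (simp add: algebra_simps)
    also have "\<dots> \<le> \<epsilon> * (\<eta> * norm a powr p) + C * ?q"
      unfolding C_def using \<delta> \<eta> C0 by (intro add_mono mult_right_mono) auto
    finally show ?thesis
      using C0(2)[of a "- (\<eta> *\<^sub>R b)"] \<eta> by (simp add: algebra_simps abs_mult)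
  qed
  show thesis
  proof
    show "0 < C" by (rule Cpos)
    fix Q :: "'a measure" and m :: "'a \<Rightarrow> 'b" and a \<eta>
    assume Q: "prob_space Q" and m: "integrable Q m" "(\<integral>z. m z \<partial>Q) = 0" and \<eta>: "0 < \<eta>" "\<eta> \<le> (1::real)"
    interpret prob_space Q by (rule Q)
    have [measurable]: "m \<in> borel_measurable Q" using m by auto
    let ?I = "\<integral>\<^sup>+z. ennreal (norm (m z) powr p) \<partial>Q"
    let ?c = "C * \<eta> powr (p / 2 + 1)"
    show "(\<integral>\<^sup>+z. ennreal (norm (a - \<eta> *\<^sub>R m z) powr p) \<partial>Q)
        \<le> ennreal ((1 + \<epsilon> * \<eta>) * norm a powr p) + ennreal ?c * ?I"
    proof (cases "?I = \<infinity>")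
      case True
      then show ?thesis using \<eta> Cpos by (simp add: ennreal_mult_top)
    next
      case False
      then have i: "integrable Q (\<lambda>z. norm (m z) powr p)"
        by (intro integrableI_nonneg) (auto simp: less_top)
      let ?R = "\<lambda>z. (1 + \<epsilon> * \<eta>) * norm a powr p - \<eta> * p * norm a powr (p - 2) * (a \<bullet> m z)
         + ?c * norm (m z) powr p"
      have iR: "integrable Q ?R" using i m by auto
      have "(\<integral>\<^sup>+z. ennreal (norm (a - \<eta> *\<^sub>R m z) powr p) \<partial>Q) \<le> (\<integral>\<^sup>+z. ennreal (?R z) \<partial>Q)"
        using \<eta> by (intro nn_integral_mono ennreal_leI pt)
      also have "\<dots> = ennreal (\<integral>z. ?R z \<partial>Q)"
      proof (rule nn_integral_eq_integral[OF iR])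
        have "0 \<le> ?R z" for z
          using pt[OF \<eta>, of a "m z"] powr_ge_zero[of "norm (a - \<eta> *\<^sub>R m z)" p] by linarith
        then show "AE z in Q. 0 \<le> ?R z" by simp
      qed
      also have "(\<integral>z. ?R z \<partial>Q) = (1 + \<epsilon> * \<eta>) * norm a powr p + ?c * (\<integral>z. norm (m z) powr p \<partial>Q)"
        using i m by (simp add: prob_space)
      also have "ennreal \<dots> = ennreal ((1 + \<epsilon> * \<eta>) * norm a powr p) + ennreal ?c * ennreal (\<integral>z. norm (m z) powr p \<partial>Q)"
        using \<eta> eps Cpos by (subst ennreal_plus) (auto simp: ennreal_mult intro!: mult_nonneg_nonneg)
      also have "ennreal (\<integral>z. norm (m z) powr p \<partial>Q) = ?I"
        by (rule nn_integral_eq_integral[OF i, symmetric]) simp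
      finally show ?thesis .
    qed
  qed
qed

section \<open>Comparison of an arbitrary norm with the Euclidean norm\<close>

lemma is_norm_props:
  assumes "is_norm N"
  shows is_norm_zero: "N 0 = 0" and is_norm_triangle: "N (x + y) \<le> N x + N y"
    and is_norm_scaleR: "N (r *\<^sub>R x) = \<bar>r\<bar> * N x" and is_norm_minus: "N (- x) = N x"
    and is_norm_nonneg: "0 \<le> N x" and is_norm_triangle_diff: "N (x - y) \<le> N x + N y"
proof -
  show z: "N 0 = 0" and t: "N (x + y) \<le> N x + N y" and s: "N (r *\<^sub>R x) = \<bar>r\<bar> * N x" for x y r
    using assms by (auto simp: is_norm_def)
  show m: "N (- x) = N x" for x using s[of "-1" x] by simp
  show "0 \<le> N x" using t[of x "- x"] z m[of x] by simp
  show "N (x - y) \<le> N x + N y" using t[of x "- y"] m[of y] by simp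
qed

lemma is_norm_sum_le:
  assumes N: "is_norm N" and "finite S"
  shows "N (\<Sum>i\<in>S. f i) \<le> (\<Sum>i\<in>S. N (f i))"
  using assms(2)
proof (induction S rule: finite_induct)
  case (insert i S)
  then show ?case using is_norm_triangle[OF N, of "f i" "sum f S"] by simp
qed (simp add: is_norm_zero[OF N])

text \<open>Expansion in the basis gives \<open>B\<close> and Lipschitz continuity; the minimum of
  \<open>N\<close> on the compact unit sphere gives \<open>A\<close>. Continuity is exported because
  measurability of \<open>N\<close> is derived from it.\<close>

lemma is_norm_equiv:
  fixes N :: "'b::euclidean_space \<Rightarrow> real"
  assumes N: "is_norm N"
  obtains A B where "0 < A" "0 < B" "\<And>x. N x \<le> B * norm x" "\<And>x. norm x \<le> A * N x" "continuous_on UNIV N"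
proof -
  define B where "B = (\<Sum>i\<in>(Basis::'b set). N i) + 1"
  have B: "B > 0" unfolding B_def by (intro add_nonneg_pos sum_nonneg is_norm_nonneg[OF N]) auto
  have NB: "N x \<le> B * norm x" for x
  proof -
    have "N x = N (\<Sum>i\<in>Basis. (x \<bullet> i) *\<^sub>R i)" by (simp add: euclidean_representation)
    also have "\<dots> \<le> (\<Sum>i\<in>Basis. N ((x \<bullet> i) *\<^sub>R i))" by (rule is_norm_sum_le[OF N]) simp
    also have "\<dots> \<le> (\<Sum>i\<in>Basis. norm x * N i)"
      by (intro sum_mono) (auto simp: is_norm_scaleR[OF N] Basis_le_norm intro!: mult_right_mono is_norm_nonneg[OF N])
    also have "\<dots> \<le> B * norm x" by (simp add: B_def algebra_simps sum_distrib_left)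
    finally show ?thesis .
  qed
  have lip: "B-lipschitz_on UNIV N"
  proof (rule lipschitz_onI)
    fix x y
    have "N x - N y \<le> N (x - y)" "N y - N x \<le> N (x - y)"
      using is_norm_triangle[OF N, of "x - y" y] is_norm_triangle[OF N, of "y - x" x]
        is_norm_minus[OF N, of "x - y"] by auto
    then show "dist (N x) (N y) \<le> B * dist x y"
      using NB[of "x - y"] by (simp add: dist_norm)
  qed (use B in simp)
  have cont: "continuous_on UNIV N" using lip by (rule lipschitz_on_continuous_on)
  obtain y where y: "norm y = 1" "\<And>x. norm x = 1 \<Longrightarrow> N y \<le> N x"
  proof -
    have "\<exists>y\<in>sphere (0::'b) 1. \<forall>x\<in>sphere 0 1. N y \<le> N x"
    proof (rule continuous_attains_inf)
      show "continuous_on (sphere 0 1) N" using cont continuous_on_subset by blast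
    qed auto
    then show thesis using that by auto
  qed
  have Ny: "N y > 0" using y(1) N is_norm_nonneg[OF N, of y] unfolding is_norm_def
    by (metis norm_zero order_le_less zero_neq_one)
  have "norm x \<le> (1 / N y) * N x" for x
  proof (cases "x = 0")
    case False
    then have "N y \<le> N ((1 / norm x) *\<^sub>R x)" by (intro y(2)) simp
    then show ?thesis using False Ny by (simp add: is_norm_scaleR[OF N] field_simps)
  qed (use is_norm_zero[OF N] in simp)
  then show thesis using that[of "1 / N y" B] Ny B NB cont by auto
qed

section \<open>The Markov property\<close>

text \<open>The set system \<open>hist\<close> repackaged as a measure, so that measurability with
  respect to the past can be stated with \<open>\<rightarrow>\<^sub>M\<close>; only its
  sigma-algebra matters.\<close>

definition hist_alg :: "'w measure \<Rightarrow> (nat \<Rightarrow> 'w \<Rightarrow> 'a::topological_space) \<Rightarrow> nat \<Rightarrow> 'w measure" where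
  "hist_alg M \<xi> t = sigma (space M) (\<Union>i\<le>t. {\<xi> i -` B \<inter> space M | B. B \<in> sets borel})"

lemma space_hist_alg [simp]: "space (hist_alg M \<xi> t) = space M"
  by (simp add: hist_alg_def space_measure_of_conv)

lemma sets_hist_alg: "sets (hist_alg M \<xi> t) = hist M \<xi> t"
  unfolding hist_alg_def hist_def by (rule sets_measure_of) auto

lemma measurable_hist_alg: "i \<le> t \<Longrightarrow> \<xi> i \<in> hist_alg M \<xi> t \<rightarrow>\<^sub>M borel"
  by (rule measurableI) (auto simp: sets_hist_alg hist_def intro!: sigma_sets.Basic)

lemma measurable_hist_alg_Suc:
  assumes "f \<in> hist_alg M \<xi> t \<rightarrow>\<^sub>M S"
  shows "f \<in> hist_alg M \<xi> (Suc t) \<rightarrow>\<^sub>M S"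
proof -
  have "hist M \<xi> t \<subseteq> hist M \<xi> (Suc t)"
    unfolding hist_def by (rule sigma_sets_mono') (auto intro: le_SucI)
  then show ?thesis using assms unfolding measurable_def by (auto simp: sets_hist_alg)
qed

lemma measurable_from_hist_alg:
  assumes \<xi>: "\<And>i. \<xi> i \<in> M \<rightarrow>\<^sub>M borel" and f: "f \<in> hist_alg M \<xi> t \<rightarrow>\<^sub>M S"
  shows "f \<in> M \<rightarrow>\<^sub>M S"
proof -
  have "hist M \<xi> t \<subseteq> sets M"
    unfolding hist_def by (rule sets.sigma_sets_subset) (use \<xi> in \<open>auto intro: measurable_sets\<close>)
  then show ?thesis using f unfolding measurable_def by (auto simp: sets_hist_alg)
qed

text \<open>The defining property of \<open>markov_chain\<close> covers products of an event of the
  past with a Borel set. These rectangles form an intersection-stable generator, so two measures on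
  the product that agree on them coincide. Keeping the whole \<open>\<omega>\<close> as first
  coordinate, with the sigma-algebra of the past, admits integrands depending on the entire
  history.\<close>

lemma markov_chain_nn_integral:
  fixes \<phi> :: "'w \<Rightarrow> 'a::topological_space \<Rightarrow> ennreal"
  assumes chain: "markov_chain M \<xi> K"
    and \<phi>[measurable]: "(\<lambda>(\<omega>, z). \<phi> \<omega> z) \<in> borel_measurable (hist_alg M \<xi> t \<Otimes>\<^sub>M borel)"
  shows "(\<integral>\<^sup>+\<omega>. \<phi> \<omega> (\<xi> (Suc t) \<omega>) \<partial>M) = (\<integral>\<^sup>+\<omega>. \<integral>\<^sup>+z. \<phi> \<omega> z \<partial>K (\<xi> t \<omega>) \<partial>M)"
proof -
  interpret prob_space M using chain by (simp add: markov_chain_def)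
  have \<xi>[measurable]: "\<xi> i \<in> M \<rightarrow>\<^sub>M borel" for i using chain by (simp add: markov_chain_def)
  have K[measurable]: "K \<in> borel \<rightarrow>\<^sub>M prob_algebra borel" using chain by (simp add: markov_chain_def)
  have K'[measurable]: "K \<in> borel \<rightarrow>\<^sub>M subprob_algebra borel" by (rule measurable_prob_algebraD[OF K])
  have Kp: "prob_space (K z)" and Ks: "sets (K z) = sets borel" for z
    using measurable_space[OF K, of z] by (auto simp: space_prob_algebra)
  let ?F = "hist_alg M \<xi> t"
  let ?P = "?F \<Otimes>\<^sub>M (borel :: 'a measure)"
  have id[measurable]: "(\<lambda>\<omega>. \<omega>) \<in> M \<rightarrow>\<^sub>M ?F"
    by (rule measurable_from_hist_alg[of \<xi> M _ t]) (use \<xi> in auto)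
  \<comment> \<open>The conditional law of the pair formed by \<open>\<omega>\<close> and the next
    state, given the past: a point mass in the first coordinate, \<open>K (\<xi> t \<omega>)\<close>
    in the second.\<close>
  define \<nu> where "\<nu> \<omega> = K (\<xi> t \<omega>) \<bind> (\<lambda>z. return ?P (\<omega>, z))" for \<omega>
  have \<nu>[measurable]: "\<nu> \<in> M \<rightarrow>\<^sub>M subprob_algebra ?P"
    unfolding \<nu>_def by measurable
  have r: "(\<lambda>z. return ?P (\<omega>, z)) \<in> borel \<rightarrow>\<^sub>M subprob_algebra ?P" if "\<omega> \<in> space M" for \<omega>
    using that by (intro measurable_compose[OF _ return_measurable] measurable_Pair1') simp
  have nu_int: "(\<integral>\<^sup>+x. f x \<partial>\<nu> \<omega>) = (\<integral>\<^sup>+z. f (\<omega>, z) \<partial>K (\<xi> t \<omega>))"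
    if \<omega>: "\<omega> \<in> space M" and f[measurable]: "f \<in> borel_measurable ?P" for \<omega> f
  proof -
    have "(\<integral>\<^sup>+x. f x \<partial>\<nu> \<omega>) = (\<integral>\<^sup>+z. \<integral>\<^sup>+x. f x \<partial>return ?P (\<omega>, z) \<partial>K (\<xi> t \<omega>))"
      unfolding \<nu>_def
      by (rule nn_integral_bind[OF f]) (use r[OF \<omega>] in \<open>simp add: measurable_cong_sets[OF Ks refl]\<close>)
    also have "\<dots> = (\<integral>\<^sup>+z. f (\<omega>, z) \<partial>K (\<xi> t \<omega>))"
      using \<omega> by (intro nn_integral_cong nn_integral_return f) (auto simp: space_pair_measure)
    finally show ?thesis .
  qed
  have eq: "distr M ?P (\<lambda>\<omega>. (\<omega>, \<xi> (Suc t) \<omega>)) = M \<bind> \<nu>"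
  proof (rule measure_eqI_generator_eq[where A="\<lambda>_. space M \<times> UNIV"
        and E="{A \<times> B | A B. A \<in> sets ?F \<and> B \<in> sets (borel::'a measure)}" and \<Omega>="space M \<times> UNIV"])
    show "Int_stable {A \<times> B | A B. A \<in> sets ?F \<and> B \<in> sets (borel::'a measure)}"
      by (rule Int_stable_pair_measure_generator)
    show "{A \<times> B | A B. A \<in> sets ?F \<and> B \<in> sets (borel::'a measure)} \<subseteq> Pow (space M \<times> UNIV)"
      using sets.sets_into_space[of _ ?F] by auto
    show "sets (distr M ?P (\<lambda>\<omega>. (\<omega>, \<xi> (Suc t) \<omega>)))
       = sigma_sets (space M \<times> UNIV) {A \<times> B | A B. A \<in> sets ?F \<and> B \<in> sets (borel::'a measure)}"
      by (simp add: sets_pair_measure)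
    show "sets (M \<bind> \<nu>)
       = sigma_sets (space M \<times> UNIV) {A \<times> B | A B. A \<in> sets ?F \<and> B \<in> sets (borel::'a measure)}"
      by (simp add: sets_bind[OF subprob_measurableD(2)[OF \<nu>]] not_empty sets_pair_measure)
    show "range (\<lambda>_::nat. space M \<times> UNIV) \<subseteq> {A \<times> B | A B. A \<in> sets ?F \<and> B \<in> sets (borel::'a measure)}"
      using sets.top[of ?F] by (subst image_subset_iff, intro ballI CollectI exI[of _ "space M"] exI[of _ UNIV]) auto
    show "emeasure (distr M ?P (\<lambda>\<omega>. (\<omega>, \<xi> (Suc t) \<omega>))) (space M \<times> UNIV) \<noteq> \<infinity>"
      using prob_space_distr[of "\<lambda>\<omega>. (\<omega>, \<xi> (Suc t) \<omega>)" ?P]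
      by (simp add: finite_measure.emeasure_finite prob_space.finite_measure)
    fix X assume "X \<in> {A \<times> B | A B. A \<in> sets ?F \<and> B \<in> sets (borel::'a measure)}"
    then obtain A B where X: "X = A \<times> B" and A[measurable]: "A \<in> sets ?F" and B[measurable]: "B \<in> sets borel"
      by auto
    have A': "A \<in> sets M" using measurable_sets[OF id A] sets.sets_into_space[OF A] by (metis Int_absorb2 space_hist_alg vimage_ident)
    have "emeasure (distr M ?P (\<lambda>\<omega>. (\<omega>, \<xi> (Suc t) \<omega>))) X = emeasure M (A \<inter> (\<xi> (Suc t) -` B \<inter> space M))"
      unfolding X using sets.sets_into_space[OF A'] by (subst emeasure_distr) (auto intro!: arg_cong[where f="emeasure M"])
    also have "\<dots> = ennreal (measure M (A \<inter> (\<xi> (Suc t) -` B \<inter> space M)))"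
      by (rule emeasure_eq_measure)
    also have "measure M (A \<inter> (\<xi> (Suc t) -` B \<inter> space M)) = (\<integral>\<omega>. indicator A \<omega> * measure (K (\<xi> t \<omega>)) B \<partial>M)"
      using chain A B unfolding markov_chain_def sets_hist_alg by blast
    also have "ennreal \<dots> = (\<integral>\<^sup>+\<omega>. ennreal (indicator A \<omega> * measure (K (\<xi> t \<omega>)) B) \<partial>M)"
    proof (rule nn_integral_eq_integral[symmetric])
      show "integrable M (\<lambda>\<omega>. indicator A \<omega> * measure (K (\<xi> t \<omega>)) B)"
        using A' Kp by (intro integrable_const_bound[where B=1])
          (auto simp: indicator_def prob_space.prob_le_1)
    qed simp
    also have "\<dots> = (\<integral>\<^sup>+\<omega>. (\<integral>\<^sup>+x. indicator X x \<partial>\<nu> \<omega>) \<partial>M)"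
    proof (rule nn_integral_cong)
      fix \<omega> assume \<omega>: "\<omega> \<in> space M"
      have "(\<integral>\<^sup>+x. indicator X x \<partial>\<nu> \<omega>) = (\<integral>\<^sup>+z. indicator A \<omega> * indicator B z \<partial>K (\<xi> t \<omega>))"
        unfolding X by (subst nu_int[OF \<omega>]) (auto simp: indicator_times)
      also have "\<dots> = indicator A \<omega> * emeasure (K (\<xi> t \<omega>)) B"
        using Ks by (subst nn_integral_cmult) auto
      finally show "ennreal (indicator A \<omega> * measure (K (\<xi> t \<omega>)) B) = (\<integral>\<^sup>+x. indicator X x \<partial>\<nu> \<omega>)"
        using Kp by (auto simp: indicator_def finite_measure.emeasure_eq_measure prob_space.finite_measure)
    qed
    also have "\<dots> = (\<integral>\<^sup>+\<omega>. emeasure (\<nu> \<omega>) X \<partial>M)"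
      unfolding X using subprob_measurableD(2)[OF \<nu>] by (intro nn_integral_cong nn_integral_indicator) auto
    also have "\<dots> = emeasure (M \<bind> \<nu>) X"
      unfolding X by (rule emeasure_bind[symmetric, OF not_empty \<nu>]) simp
    finally show "emeasure (distr M ?P (\<lambda>\<omega>. (\<omega>, \<xi> (Suc t) \<omega>))) X = emeasure (M \<bind> \<nu>) X" .
  qed (auto simp: not_empty)
  have "(\<integral>\<^sup>+\<omega>. \<phi> \<omega> (\<xi> (Suc t) \<omega>) \<partial>M) = (\<integral>\<^sup>+x. (case x of (\<omega>, z) \<Rightarrow> \<phi> \<omega> z) \<partial>distr M ?P (\<lambda>\<omega>. (\<omega>, \<xi> (Suc t) \<omega>)))"
    by (subst nn_integral_distr) auto
  also have "\<dots> = (\<integral>\<^sup>+\<omega>. (\<integral>\<^sup>+x. (case x of (\<omega>, z) \<Rightarrow> \<phi> \<omega> z) \<partial>\<nu> \<omega>) \<partial>M)"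
    unfolding eq by (rule nn_integral_bind[OF \<phi> \<nu>])
  also have "\<dots> = (\<integral>\<^sup>+\<omega>. \<integral>\<^sup>+z. \<phi> \<omega> z \<partial>K (\<xi> t \<omega>) \<partial>M)"
    by (intro nn_integral_cong) (simp add: nu_int)
  finally show ?thesis .
qed

section \<open>Total variation and the Poisson equation\<close>

lemma dtv_upper:
  assumes "prob_space \<mu>" "prob_space \<nu>" and A: "A \<in> sets borel"
  shows "\<bar>measure \<mu> A - measure \<nu> A\<bar> \<le> dtv \<mu> \<nu>"
  unfolding dtv_def
proof (rule cSUP_upper[OF A], rule bdd_aboveI2[where M=1])
  fix A
  show "\<bar>measure \<mu> A - measure \<nu> A\<bar> \<le> 1"
    using prob_space.prob_le_1[of \<mu> A] prob_space.prob_le_1[of \<nu> A] assms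
      measure_nonneg[of \<mu> A] measure_nonneg[of \<nu> A] by linarith
qed

lemma dtv_nonneg: "prob_space \<mu> \<Longrightarrow> prob_space \<nu> \<Longrightarrow> 0 \<le> dtv \<mu> \<nu>"
  using dtv_upper[of \<mu> \<nu> "{}"] by simp

text \<open>Layer-cake formula: both integrals are integrals over levels \<open>s\<close> in
  \<open>[0, B)\<close> of the masses of \<open>{z. s < f z}\<close>, and at each level these masses
  differ by at most the total variation distance.\<close>

lemma dtv_nn_integral_le:
  fixes \<mu> \<nu> :: "'a::topological_space measure"
  assumes \<mu>: "prob_space \<mu>" "sets \<mu> = sets borel" and \<nu>: "prob_space \<nu>" "sets \<nu> = sets borel"
    and f[measurable]: "f \<in> borel_measurable borel" and f0: "\<And>z. 0 \<le> f z" and fB: "\<And>z. f z \<le> B"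
  shows "(\<integral>\<^sup>+z. ennreal (f z) \<partial>\<mu>) \<le> (\<integral>\<^sup>+z. ennreal (f z) \<partial>\<nu>) + ennreal (B * dtv \<mu> \<nu>)"
proof -
  interpret mu: prob_space \<mu> by fact
  interpret nu: prob_space \<nu> by fact
  have B0: "0 \<le> B" using f0 fB order_trans by blast
  note d = dtv_upper[OF \<mu>(1) \<nu>(1)] and d0 = dtv_nonneg[OF \<mu>(1) \<nu>(1)]
  have layer: "(\<integral>\<^sup>+z. ennreal (f z) \<partial>Q) = (\<integral>\<^sup>+s. indicator {0..<B} s * emeasure Q {z. s < f z} \<partial>lborel)"
    if Q: "prob_space Q" and Qs[measurable_cong]: "sets Q = sets borel" for Q :: "'a measure"
  proof -
    interpret Q: prob_space Q by (rule Q)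
    interpret pair_sigma_finite Q lborel by unfold_locales
    have "(\<integral>\<^sup>+z. ennreal (f z) \<partial>Q) = (\<integral>\<^sup>+z. \<integral>\<^sup>+s. indicator {0..<B} s * indicator {s. s < f z} s \<partial>lborel \<partial>Q)"
    proof (rule nn_integral_cong)
      fix z
      have "(\<integral>\<^sup>+s. indicator {0..<B} s * indicator {s. s < f z} s \<partial>lborel) = (\<integral>\<^sup>+s. indicator {0..<f z} s \<partial>lborel)"
        using fB[of z] by (intro nn_integral_cong) (auto simp: indicator_def)
      also have "\<dots> = ennreal (f z)" using f0[of z] by simp
      finally show "ennreal (f z) = (\<integral>\<^sup>+s. indicator {0..<B} s * indicator {s. s < f z} s \<partial>lborel)" by simp
    qed
    also have "\<dots> = (\<integral>\<^sup>+s. \<integral>\<^sup>+z. indicator {0..<B} s * indicator {s. s < f z} s \<partial>Q \<partial>lborel)"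
      by (rule Fubini'[symmetric]) measurable
    also have "\<dots> = (\<integral>\<^sup>+s. indicator {0..<B} s * emeasure Q {z. s < f z} \<partial>lborel)"
    proof (rule nn_integral_cong)
      fix s :: real
      have [measurable]: "{z. s < f z} \<in> sets borel" by measurable
      have "(\<integral>\<^sup>+z. indicator {0..<B} s * indicator {s. s < f z} s \<partial>Q) = (\<integral>\<^sup>+z. indicator {0..<B} s * indicator {z. s < f z} z \<partial>Q)"
        by (intro nn_integral_cong) (auto simp: indicator_def)
      also have "\<dots> = indicator {0..<B} s * emeasure Q {z. s < f z}"
        by (subst nn_integral_cmult) (auto simp: Qs)
      finally show "(\<integral>\<^sup>+z. indicator {0..<B} s * indicator {s. s < f z} s \<partial>Q) = indicator {0..<B} s * emeasure Q {z. s < f z}" .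
    qed
    finally show ?thesis .
  qed
  have "(\<integral>\<^sup>+z. ennreal (f z) \<partial>\<mu>) = (\<integral>\<^sup>+s. indicator {0..<B} s * emeasure \<mu> {z. s < f z} \<partial>lborel)"
    by (rule layer) fact+
  also have "\<dots> \<le> (\<integral>\<^sup>+s. indicator {0..<B} s * emeasure \<nu> {z. s < f z} + ennreal (dtv \<mu> \<nu>) * indicator {0..<B} s \<partial>lborel)"
  proof (rule nn_integral_mono)
    fix s :: real
    have "measure \<mu> {z. s < f z} \<le> measure \<nu> {z. s < f z} + dtv \<mu> \<nu>"
      using d[of "{z. s < f z}"] by simp
    then have "emeasure \<mu> {z. s < f z} \<le> emeasure \<nu> {z. s < f z} + ennreal (dtv \<mu> \<nu>)"
      unfolding mu.emeasure_eq_measure nu.emeasure_eq_measure using d0 by (simp flip: ennreal_plus)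
    then show "indicator {0..<B} s * emeasure \<mu> {z. s < f z}
        \<le> indicator {0..<B} s * emeasure \<nu> {z. s < f z} + ennreal (dtv \<mu> \<nu>) * indicator {0..<B} s"
      by (auto simp: indicator_def)
  qed
  also have "\<dots> = (\<integral>\<^sup>+s. indicator {0..<B} s * emeasure \<nu> {z. s < f z} \<partial>lborel)
      + (\<integral>\<^sup>+s. ennreal (dtv \<mu> \<nu>) * indicator {0..<B} s \<partial>lborel)"
  proof (rule nn_integral_add)
    have [measurable]: "(\<lambda>s. emeasure \<nu> {z. s < f z}) \<in> borel_measurable borel"
    proof -
      have [measurable_cong]: "sets \<nu> = sets borel" by fact
      have "(\<lambda>s. emeasure \<nu> {z \<in> space \<nu>. s < f z}) \<in> borel_measurable borel"
        by measurable
      moreover have "space \<nu> = UNIV" using sets_eq_imp_space_eq[OF \<nu>(2)] by simp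
      ultimately show ?thesis by simp
    qed
    show "(\<lambda>s. indicator {0..<B} s * emeasure \<nu> {z. s < f z}) \<in> borel_measurable lborel" by measurable
  qed simp
  also have "(\<integral>\<^sup>+s. indicator {0..<B} s * emeasure \<nu> {z. s < f z} \<partial>lborel) = (\<integral>\<^sup>+z. ennreal (f z) \<partial>\<nu>)"
    by (rule layer[symmetric]) fact+
  also have "(\<integral>\<^sup>+s. ennreal (dtv \<mu> \<nu>) * indicator {0..<B} s \<partial>lborel) = ennreal (B * dtv \<mu> \<nu>)"
    using B0 d0 by (subst nn_integral_cmult) (auto simp: ennreal_mult mult.commute)
  finally show ?thesis .
qed

lemma dtv_sym: "dtv \<mu> \<nu> = dtv \<nu> \<mu>"
  by (simp add: dtv_def abs_minus_commute)

text \<open>Shifting \<open>f\<close> by \<open>B\<close> makes it nonnegative with upper bound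
  \<open>2 * B\<close>, which is the origin of the factor 2.\<close>

lemma dtv_integral_le:
  fixes \<mu> \<nu> :: "'a::topological_space measure"
  assumes \<mu>: "prob_space \<mu>" "sets \<mu> = sets borel" and \<nu>: "prob_space \<nu>" "sets \<nu> = sets borel"
    and f[measurable]: "f \<in> borel_measurable borel" and fB: "\<And>z. \<bar>f z\<bar> \<le> B"
  shows "\<bar>(\<integral>z. f z \<partial>\<mu>) - (\<integral>z. f z \<partial>\<nu>)\<bar> \<le> 2 * B * dtv \<mu> \<nu>"
proof -
  have B0: "0 \<le> B" using fB by (meson abs_ge_zero order_trans)
  have f': "0 \<le> f z + B" "f z + B \<le> 2 * B" for z using fB[of z] by auto
  have int: "integrable Q f" if "prob_space Q" "sets Q = sets borel" for Q :: "'a measure"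
  proof -
    interpret prob_space Q by fact
    have [measurable_cong]: "sets Q = sets borel" by fact
    show ?thesis using fB by (intro integrable_const_bound[where B=B]) auto
  qed
  have *: "(\<integral>z. f z \<partial>Q) \<le> (\<integral>z. f z \<partial>R) + 2 * B * dtv Q R"
    if Q: "prob_space Q" "sets Q = sets borel" and R: "prob_space R" "sets R = sets borel" for Q R :: "'a measure"
  proof -
    interpret Q: prob_space Q by fact
    interpret R: prob_space R by fact
    note d0 = dtv_nonneg[OF Q(1) R(1)]
    have "ennreal ((\<integral>z. f z \<partial>Q) + B) = (\<integral>\<^sup>+z. ennreal (f z + B) \<partial>Q)"
      using f' int[OF Q] by (subst nn_integral_eq_integral) (auto simp: Q.prob_space)
    also have "\<dots> \<le> (\<integral>\<^sup>+z. ennreal (f z + B) \<partial>R) + ennreal (2 * B * dtv Q R)"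
      using f' by (intro dtv_nn_integral_le Q R) auto
    also have "(\<integral>\<^sup>+z. ennreal (f z + B) \<partial>R) = ennreal ((\<integral>z. f z \<partial>R) + B)"
      using f' int[OF R] by (subst nn_integral_eq_integral) (auto simp: R.prob_space)
    also have "\<dots> + ennreal (2 * B * dtv Q R) = ennreal ((\<integral>z. f z \<partial>R) + B + 2 * B * dtv Q R)"
    proof (rule ennreal_plus[symmetric])
      have "0 \<le> (\<integral>z. f z + B \<partial>R)" using f' by (intro Bochner_Integration.integral_nonneg) auto
      then show "0 \<le> (\<integral>z. f z \<partial>R) + B" using int[OF R] by (simp add: R.prob_space)
    qed (use B0 d0 in auto)
    finally show ?thesis
    proof (subst (asm) ennreal_le_iff)
      have "0 \<le> (\<integral>z. f z + B \<partial>R)" using f' by (intro Bochner_Integration.integral_nonneg) auto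
      then show "0 \<le> (\<integral>z. f z \<partial>R) + B + 2 * B * dtv Q R"
        using int[OF R] B0 d0 by (simp add: R.prob_space)
    qed simp
  qed
  show ?thesis using *[OF \<mu> \<nu>] *[OF \<nu> \<mu>] dtv_sym[of \<mu> \<nu>] by (simp add: abs_le_iff)
qed

section \<open>Iterated kernels, invariance of integrals and the Poisson equation\<close>

lemma kernel_props:
  assumes "K \<in> borel \<rightarrow>\<^sub>M prob_algebra borel"
  shows kernel_prob_space: "prob_space (K z)" and kernel_sets: "sets (K z) = sets borel"
  using measurable_space[OF assms, of z] by (auto simp: space_prob_algebra)

lemma measurable_kpow:
  assumes K: "K \<in> borel \<rightarrow>\<^sub>M prob_algebra borel"
  shows "kpow K n \<in> borel \<rightarrow>\<^sub>M prob_algebra borel"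
proof (induction n)
  case 0
  have "kpow K 0 = return borel" by (rule ext) simp
  then show ?case by simp
next
  case (Suc n)
  have "kpow K (Suc n) = (\<lambda>z. K z \<bind> kpow K n)" by (rule ext) simp
  then show ?case using measurable_bind_prob_space[OF K Suc] by simp
qed

text \<open>Turns the setwise definition of stationarity into an equation of measures, so that
  integrals against \<open>\<pi>\<close> can be disintegrated along \<open>K\<close>.\<close>

lemma stationary_bind:
  assumes K: "K \<in> borel \<rightarrow>\<^sub>M prob_algebra borel" and \<pi>: "stationary K \<pi>"
  shows "\<pi> \<bind> K = \<pi>"
proof -
  interpret prob_space \<pi> using \<pi> by (simp add: stationary_def)
  have \<pi>s: "sets \<pi> = sets borel" using \<pi> by (simp add: stationary_def)
  have K': "K \<in> \<pi> \<rightarrow>\<^sub>M subprob_algebra borel"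
    using measurable_prob_algebraD[OF K] by (simp add: measurable_cong_sets[OF \<pi>s refl])
  have P: "prob_space (\<pi> \<bind> K)"
    by (rule prob_space_bind[OF _ K']) (simp add: kernel_prob_space[OF K])
  show ?thesis
  proof (rule measure_eqI)
    show "sets (\<pi> \<bind> K) = sets \<pi>"
      using sets_bind[of \<pi> K borel] by (simp add: kernel_sets[OF K] not_empty \<pi>s)
    then have sB: "sets (\<pi> \<bind> K) = sets borel" using \<pi>s by simp
    fix A assume "A \<in> sets (\<pi> \<bind> K)"
    then have A: "A \<in> sets borel" using sB by simp
    have "measure (\<pi> \<bind> K) A = (\<integral>z. measure (K z) A \<partial>\<pi>)"
      by (rule measure_bind[OF K' A])
    also have "\<dots> = measure \<pi> A" using \<pi> A by (simp add: stationary_def)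
    finally show "emeasure (\<pi> \<bind> K) A = emeasure \<pi> A"
      by (simp add: emeasure_eq_measure finite_measure.emeasure_eq_measure[OF prob_space.finite_measure[OF P]])
  qed
qed

text \<open>For nonnegative functions this is disintegration of \<open>\<pi> \<bind> K\<close>; the
  general case subtracts negative from positive part, both integrable under every \<open>K z\<close>
  and under \<open>\<pi>\<close>.\<close>

lemma stationary_integral_real:
  fixes f :: "'a::topological_space \<Rightarrow> real"
  assumes K: "K \<in> borel \<rightarrow>\<^sub>M prob_algebra borel" and \<pi>: "stationary K \<pi>"
    and f[measurable]: "f \<in> borel_measurable borel"
    and intK: "\<And>z. integrable (K z) f" and int\<pi>: "integrable \<pi> f"
  shows "(\<integral>z. (\<integral>z'. f z' \<partial>K z) \<partial>\<pi>) = (\<integral>z. f z \<partial>\<pi>)"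
proof -
  have \<pi>s[measurable_cong]: "sets \<pi> = sets borel" using \<pi> by (simp add: stationary_def)
  have K'[measurable]: "K \<in> borel \<rightarrow>\<^sub>M subprob_algebra borel" using measurable_prob_algebraD[OF K] .
  have nonneg: "integrable \<pi> (\<lambda>z. \<integral>z'. g z' \<partial>K z) \<and> (\<integral>z. (\<integral>z'. g z' \<partial>K z) \<partial>\<pi>) = (\<integral>z. g z \<partial>\<pi>)"
    if [measurable]: "g \<in> borel_measurable borel" and g0: "\<And>z. 0 \<le> g z"
      and gK: "\<And>z. integrable (K z) g" and g\<pi>: "integrable \<pi> g" for g :: "'a \<Rightarrow> real"
  proof -
    have m[measurable]: "(\<lambda>z. \<integral>z'. g z' \<partial>K z) \<in> borel_measurable borel"
      by (rule measurable_compose[OF K']) simp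
    have "(\<integral>\<^sup>+z. ennreal (\<integral>z'. g z' \<partial>K z) \<partial>\<pi>) = (\<integral>\<^sup>+z. (\<integral>\<^sup>+z'. ennreal (g z') \<partial>K z) \<partial>\<pi>)"
      using g0 gK by (simp add: nn_integral_eq_integral)
    also have "\<dots> = (\<integral>\<^sup>+z. ennreal (g z) \<partial>(\<pi> \<bind> K))"
      by (rule nn_integral_bind[symmetric, where B=borel]) simp_all
    also have "\<dots> = ennreal (\<integral>z. g z \<partial>\<pi>)"
      using g0 g\<pi> by (simp add: stationary_bind[OF K \<pi>] nn_integral_eq_integral)
    finally have *: "(\<integral>\<^sup>+z. ennreal (\<integral>z'. g z' \<partial>K z) \<partial>\<pi>) = ennreal (\<integral>z. g z \<partial>\<pi>)" .
    show ?thesis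
    proof
      show "integrable \<pi> (\<lambda>z. \<integral>z'. g z' \<partial>K z)"
        using * g0 by (intro integrableI_nonneg) auto
      show "(\<integral>z. (\<integral>z'. g z' \<partial>K z) \<partial>\<pi>) = (\<integral>z. g z \<partial>\<pi>)"
        using * g0 by (subst integral_eq_nn_integral) auto
    qed
  qed
  let ?f1 = "\<lambda>z. max 0 (f z)" and ?f2 = "\<lambda>z. max 0 (- f z)"
  have 1: "integrable \<pi> (\<lambda>z. \<integral>z'. ?f1 z' \<partial>K z) \<and> (\<integral>z. (\<integral>z'. ?f1 z' \<partial>K z) \<partial>\<pi>) = (\<integral>z. ?f1 z \<partial>\<pi>)"
    using intK int\<pi> by (intro nonneg) (auto intro: integrable_max)
  have 2: "integrable \<pi> (\<lambda>z. \<integral>z'. ?f2 z' \<partial>K z) \<and> (\<integral>z. (\<integral>z'. ?f2 z' \<partial>K z) \<partial>\<pi>) = (\<integral>z. ?f2 z \<partial>\<pi>)"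
    using intK int\<pi> by (intro nonneg) (auto intro: integrable_max)
  have eq: "f = (\<lambda>z. ?f1 z - ?f2 z)" by auto
  have split: "integral\<^sup>L Q f = (\<integral>z. ?f1 z \<partial>Q) - (\<integral>z. ?f2 z \<partial>Q)" if "integrable Q f" for Q
    using that by (subst eq, intro Bochner_Integration.integral_diff) auto
  have "(\<integral>z. (\<integral>z'. f z' \<partial>K z) \<partial>\<pi>) = (\<integral>z. (\<integral>z'. ?f1 z' \<partial>K z) - (\<integral>z'. ?f2 z' \<partial>K z) \<partial>\<pi>)"
    by (intro Bochner_Integration.integral_cong refl split intK)
  also have "\<dots> = (\<integral>z. (\<integral>z'. ?f1 z' \<partial>K z) \<partial>\<pi>) - (\<integral>z. (\<integral>z'. ?f2 z' \<partial>K z) \<partial>\<pi>)"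
    by (intro Bochner_Integration.integral_diff conjunct1[OF 1] conjunct1[OF 2])
  also have "\<dots> = (\<integral>z. f z \<partial>\<pi>)"
    by (simp only: conjunct2[OF 1] conjunct2[OF 2] split[OF int\<pi>])
  finally show ?thesis .
qed

lemma stationary_integral:
  fixes f :: "'a::topological_space \<Rightarrow> 'b::euclidean_space"
  assumes K: "K \<in> borel \<rightarrow>\<^sub>M prob_algebra borel" and \<pi>: "stationary K \<pi>"
    and f[measurable]: "f \<in> borel_measurable borel"
    and intK: "\<And>z. integrable (K z) f" and int\<pi>: "integrable \<pi> f"
    and intKf: "integrable \<pi> (\<lambda>z. \<integral>z'. f z' \<partial>K z)"
  shows "(\<integral>z. (\<integral>z'. f z' \<partial>K z) \<partial>\<pi>) = (\<integral>z. f z \<partial>\<pi>)"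
proof (rule euclidean_eqI)
  fix i :: 'b assume "i \<in> Basis"
  have "(\<integral>z. (\<integral>z'. f z' \<partial>K z) \<partial>\<pi>) \<bullet> i = (\<integral>z. (\<integral>z'. f z' \<bullet> i \<partial>K z) \<partial>\<pi>)"
    using intKf intK by simp
  also have "\<dots> = (\<integral>z. f z \<bullet> i \<partial>\<pi>)"
    using intK int\<pi> by (intro stationary_integral_real[OF K \<pi>]) auto
  also have "\<dots> = (\<integral>z. f z \<partial>\<pi>) \<bullet> i"
    using int\<pi> by simp
  finally show "(\<integral>z. (\<integral>z'. f z' \<partial>K z) \<partial>\<pi>) \<bullet> i = (\<integral>z. f z \<partial>\<pi>) \<bullet> i" .
qed

text \<open>The solution is the Neumann series of the averages of \<open>b\<close> under the
  iterated kernels. Since \<open>b\<close> has mean zero under \<open>\<pi>\<close>, mixing makes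
  the terms decay like \<open>\<rho> ^ k\<close> uniformly in the starting point, and applying
  \<open>K\<close> shifts the series by one term.\<close>

lemma poisson_equation:
  fixes b :: "'a::topological_space \<Rightarrow> 'b::euclidean_space"
  assumes K: "K \<in> borel \<rightarrow>\<^sub>M prob_algebra borel"
    and \<pi>: "prob_space \<pi>" "sets \<pi> = sets borel"
    and b[measurable]: "b \<in> borel_measurable borel" and bS: "\<And>z. norm (b z) \<le> S"
    and mean: "(\<integral>z. b z \<partial>\<pi>) = 0"
    and rho: "0 \<le> \<rho>" "\<rho> < 1" and mix: "\<And>z t. dtv (kpow K t z) \<pi> \<le> \<kappa> * \<rho> ^ t / 2"
  obtains h D where "h \<in> borel_measurable borel" "\<And>z. norm (h z) \<le> D"
    "\<And>z. (\<integral>z'. h z' \<partial>K z) = h z - b z"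
proof -
  have S0: "0 \<le> S" using bS norm_ge_zero order_trans by blast
  define q where "q k z = (\<integral>z'. b z' \<partial>kpow K k z)" for k z
  note Kp = measurable_kpow[OF K]
  note Kp'[measurable] = measurable_prob_algebraD[OF Kp]
  note K'[measurable] = measurable_prob_algebraD[OF K]
  have q_meas[measurable]: "q k \<in> borel_measurable borel" for k
    unfolding q_def by (rule measurable_compose[OF Kp']) simp
  have bint: "integrable Q b" if "prob_space Q" "sets Q = sets borel" for Q :: "'a measure"
  proof -
    interpret prob_space Q by fact
    have [measurable_cong]: "sets Q = sets borel" by fact
    show ?thesis using bS by (intro integrable_const_bound[where B=S]) auto
  qed
  \<comment> \<open>The total variation estimate is scalar and is applied to each coordinate, hence
    the dimension; its factor 2 cancels the 1/2 in the mixing bound.\<close>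
  define C where "C = real DIM('b) * S * \<kappa>"
  have q_bound: "norm (q k z) \<le> C * \<rho> ^ k" for k z
  proof -
    have "norm (q k z) \<le> (\<Sum>i\<in>Basis. \<bar>q k z \<bullet> i\<bar>)" by (rule norm_le_l1)
    also have "\<dots> \<le> (\<Sum>i\<in>(Basis::'b set). S * \<kappa> * \<rho> ^ k)"
    proof (rule sum_mono)
      fix i :: 'b assume i: "i \<in> Basis"
      have "q k z \<bullet> i = (\<integral>z'. b z' \<bullet> i \<partial>kpow K k z)"
        unfolding q_def using bint[OF kernel_prob_space[OF Kp] kernel_sets[OF Kp]] by simp
      moreover have "0 = (\<integral>z'. b z' \<bullet> i \<partial>\<pi>)" using bint[OF \<pi>] mean by simp
      ultimately have "\<bar>q k z \<bullet> i\<bar> = \<bar>(\<integral>z'. b z' \<bullet> i \<partial>kpow K k z) - (\<integral>z'. b z' \<bullet> i \<partial>\<pi>)\<bar>" by simp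
      also have "\<dots> \<le> 2 * S * dtv (kpow K k z) \<pi>"
        using bS Basis_le_norm[OF i] order_trans
        by (intro dtv_integral_le kernel_prob_space[OF Kp] kernel_sets[OF Kp] \<pi>) (measurable, blast)
      also have "\<dots> \<le> 2 * S * (\<kappa> * \<rho> ^ k / 2)"
        using S0 by (intro mult_left_mono mix) auto
      finally show "\<bar>q k z \<bullet> i\<bar> \<le> S * \<kappa> * \<rho> ^ k" by simp
    qed
    also have "\<dots> = C * \<rho> ^ k" by (simp add: C_def)
    finally show ?thesis .
  qed
  have summ: "summable (\<lambda>k. C * \<rho> ^ k)" using rho by (intro summable_mult summable_geometric) auto
  have qsumm: "summable (\<lambda>k. norm (q k z))" for z
    by (rule summable_comparison_test'[OF summ]) (simp add: q_bound)
  have q0: "q 0 z = b z" for z unfolding q_def by (simp add: integral_return)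
  \<comment> \<open>\<open>kpow\<close> takes its first step with \<open>K\<close> and the remaining
    \<open>k\<close> afterwards, so the shift identity is the disintegration of a
    \<open>bind\<close>.\<close>
  have qSuc: "q (Suc k) z = (\<integral>z'. q k z' \<partial>K z)" for k z
  proof (rule euclidean_eqI)
    fix i :: 'b assume i: "i \<in> Basis"
    interpret prob_space "K z" by (rule kernel_prob_space[OF K])
    have Ks[measurable_cong]: "sets (K z) = sets borel" by (rule kernel_sets[OF K])
    have qi: "integrable (K z) (q k)"
      using q_bound[of k] by (intro integrable_const_bound[where B="C * \<rho> ^ k"]) auto
    have "q (Suc k) z \<bullet> i = (\<integral>z'. b z' \<bullet> i \<partial>(K z \<bind> kpow K k))"
      unfolding q_def using bint[OF kernel_prob_space[OF Kp] kernel_sets[OF Kp], of "Suc k" z] by simp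
    also have "\<dots> = (\<integral>z'. (\<integral>y. b y \<bullet> i \<partial>kpow K k z') \<partial>K z)"
    proof (rule integral_bind[where K=borel and B=S and B'=1])
      show "\<bar>b x \<bullet> i\<bar> \<le> S" for x using bS Basis_le_norm[OF i] order_trans by blast
      show "AE x in K z. emeasure (kpow K k x) (space (kpow K k x)) \<le> ennreal 1"
        using kernel_prob_space[OF Kp] by (simp add: prob_space.emeasure_space_1)
    qed (measurable, unfold_locales)
    also have "\<dots> = (\<integral>z'. q k z' \<bullet> i \<partial>K z)"
      unfolding q_def using bint[OF kernel_prob_space[OF Kp] kernel_sets[OF Kp]] by simp
    also have "\<dots> = (\<integral>z'. q k z' \<partial>K z) \<bullet> i" using qi by simp
    finally show "q (Suc k) z \<bullet> i = (\<integral>z'. q k z' \<partial>K z) \<bullet> i" .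
  qed
  define h where "h z = (\<Sum>k. q k z)" for z
  show thesis
  proof
    show "h \<in> borel_measurable borel" unfolding h_def by measurable
    show "norm (h z) \<le> (\<Sum>k. C * \<rho> ^ k)" for z
      unfolding h_def by (rule norm_suminf_le[OF q_bound summ])
    fix z
    interpret prob_space "K z" by (rule kernel_prob_space[OF K])
    have Ks[measurable_cong]: "sets (K z) = sets borel" by (rule kernel_sets[OF K])
    have qi: "integrable (K z) (q k)" for k
      using q_bound[of k] by (intro integrable_const_bound[where B="C * \<rho> ^ k"]) auto
    have "(\<integral>z'. h z' \<partial>K z) = (\<Sum>k. \<integral>z'. q k z' \<partial>K z)"
      unfolding h_def
    proof (rule integral_suminf[OF qi])
      show "AE z' in K z. summable (\<lambda>k. norm (q k z'))" by (simp add: qsumm)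
      show "summable (\<lambda>k. \<integral>z'. norm (q k z') \<partial>K z)"
      proof (rule summable_comparison_test'[OF summ])
        fix k
        have "(\<integral>z'. norm (q k z') \<partial>K z) \<le> (\<integral>z'. C * \<rho> ^ k \<partial>K z)"
          using qi q_bound by (intro integral_mono) auto
        then show "norm (\<integral>z'. norm (q k z') \<partial>K z) \<le> C * \<rho> ^ k" by (simp add: prob_space)
      qed
    qed
    also have "\<dots> = (\<Sum>k. q (Suc k) z)" by (simp add: qSuc)
    also have "\<dots> = h z - b z"
      unfolding h_def using suminf_split_head[OF summable_norm_cancel[OF qsumm]] by (simp add: q0)
    finally show "(\<integral>z'. h z' \<partial>K z) = h z - b z" .
  qed
qed

section \<open>Stochastic approximation\<close>

text \<open>Ergodicity enters this setting only through \<open>h\<close>, a bounded solution of the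
  Poisson equation for \<open>PH xs\<close>. The moment recursions then involve neither mixing rates
  nor the stationary law.\<close>

locale sa_markov =
  fixes M :: "'w measure" and \<xi> :: "nat \<Rightarrow> 'w \<Rightarrow> 'a::polish_space" and K :: "'a \<Rightarrow> 'a measure"
    and N :: "'b::euclidean_space \<Rightarrow> real" and H :: "'b \<Rightarrow> 'a \<Rightarrow> 'b" and \<eta> :: "nat \<Rightarrow> real"
    and xs x0 :: 'b and p c \<gamma> Mc G D :: real and g :: "'a \<Rightarrow> real" and h :: "'a \<Rightarrow> 'b"
  assumes chain: "markov_chain M \<xi> K" and norm: "is_norm N"
    and H_meas: "(\<lambda>(x, z). H x z) \<in> borel_measurable (borel \<Otimes>\<^sub>M borel)"
    and H_intK: "\<And>x z. integrable (K z) (H x)"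
    and p: "2 < p"
    and \<gamma>: "0 \<le> \<gamma>" "\<gamma> < 1" and c: "0 < c"
    and contraction: "\<And>x y z. N ((\<integral>z'. H x z' - H y z' \<partial>K z) - c *\<^sub>R (x - y)) \<le> \<gamma> * c * N (x - y)"
    and g: "g \<in> borel_measurable borel" "\<And>z. 0 \<le> g z"
    and growth: "0 < Mc" "\<And>x z. N (H x z) \<le> Mc * (N x + g z)"
    and g_moment: "\<And>t. (\<integral>\<^sup>+ \<omega>. ennreal (g (\<xi> t \<omega>) powr p) \<partial>M) \<le> ennreal G"
    and \<eta>_pos: "\<And>t. 0 < \<eta> t" and \<eta>_le_1: "\<And>t. \<eta> t \<le> 1"
    and h_meas: "h \<in> borel_measurable borel" and h_bound: "\<And>z. norm (h z) \<le> D"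
    and poisson: "\<And>z. (\<integral>z'. h z' \<partial>K z) = h z - (\<integral>z'. H xs z' \<partial>K z)"
begin

sublocale prob_space M using chain by (simp add: markov_chain_def)

abbreviation X :: "nat \<Rightarrow> 'w \<Rightarrow> 'b" where "X \<equiv> sa_iter H \<eta> \<xi> x0"
abbreviation PH :: "'b \<Rightarrow> 'a \<Rightarrow> 'b" where "PH x z \<equiv> \<integral>z'. H x z' \<partial>K z"

section \<open>Measurability and a priori finiteness of the moments\<close>

lemma K_meas: "K \<in> borel \<rightarrow>\<^sub>M prob_algebra borel"
  using chain by (simp add: markov_chain_def)

lemma K_meas' [measurable]: "K \<in> borel \<rightarrow>\<^sub>M subprob_algebra borel"
  by (rule measurable_prob_algebraD[OF K_meas])

lemmas K_prob = kernel_prob_space[OF K_meas]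
lemmas K_sets [measurable_cong] = kernel_sets[OF K_meas]

lemma \<xi>_meas [measurable]: "\<xi> t \<in> M \<rightarrow>\<^sub>M borel"
  using chain by (simp add: markov_chain_def)

lemma g_meas [measurable]: "g \<in> borel_measurable borel" by (rule g)

lemma h_meas' [measurable]: "h \<in> borel_measurable borel" by (rule h_meas)

lemma H_compose [measurable (raw)]:
  assumes "f1 \<in> borel_measurable Q" "f2 \<in> Q \<rightarrow>\<^sub>M borel"
  shows "(\<lambda>\<omega>. H (f1 \<omega>) (f2 \<omega>)) \<in> borel_measurable Q"
  using measurable_compose[OF measurable_Pair[OF assms] H_meas] by simp

lemma PH_compose [measurable (raw)]:
  assumes [measurable]: "f1 \<in> borel_measurable Q" "f2 \<in> Q \<rightarrow>\<^sub>M borel"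
  shows "(\<lambda>\<omega>. PH (f1 \<omega>) (f2 \<omega>)) \<in> borel_measurable Q"
  by (rule integral_kernel_measurable[where S=borel]) measurable

lemma N_meas [measurable]: "N \<in> borel_measurable borel"
proof -
  obtain A B where "continuous_on UNIV N" using is_norm_equiv[OF norm] by metis
  then show ?thesis by (rule borel_measurable_continuous_onI)
qed

lemmas N_nonneg [simp] = is_norm_nonneg[OF norm]
lemmas N_triangle = is_norm_triangle[OF norm]
lemmas N_triangle_diff = is_norm_triangle_diff[OF norm]
lemmas N_scaleR = is_norm_scaleR[OF norm]

text \<open>The index shift matters: iterate \<open>Suc t\<close> is built from
  \<open>\<xi> 0\<close> to \<open>\<xi> t\<close>, so it is already determined when the transition
  to \<open>\<xi> (Suc t)\<close> is drawn.\<close>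

lemma X_hist_meas: "X (Suc t) \<in> borel_measurable (hist_alg M \<xi> t)"
proof (induction t)
  case 0
  have [measurable]: "\<xi> 0 \<in> hist_alg M \<xi> 0 \<rightarrow>\<^sub>M borel" by (rule measurable_hist_alg) simp
  show ?case by simp
next
  case (Suc t)
  have [measurable]: "X (Suc t) \<in> borel_measurable (hist_alg M \<xi> (Suc t))"
    by (rule measurable_hist_alg_Suc[OF Suc])
  have [measurable]: "\<xi> (Suc t) \<in> hist_alg M \<xi> (Suc t) \<rightarrow>\<^sub>M borel" by (rule measurable_hist_alg) simp
  show ?case by (subst sa_iter.simps(2)[abs_def]) measurable
qed

lemma X_meas [measurable]: "X t \<in> borel_measurable M"
proof (cases t)
  case (Suc n)
  then show ?thesis using measurable_from_hist_alg[OF \<xi>_meas X_hist_meas] by simp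
qed (simp add: sa_iter.simps(1)[abs_def])

text \<open>Linear growth of \<open>H\<close> propagates finiteness from one iterate to the next.
  The bound is not uniform in \<open>t\<close>; it only provides a finite starting value for the
  moment recursion and handles the finitely many early times.\<close>

lemma X_moment_finite: "(\<integral>\<^sup>+\<omega>. ennreal (N (X t \<omega> - xs) powr p) \<partial>M) < \<infinity>"
proof (induction t)
  case 0
  show ?case by (simp add: emeasure_space_1 ennreal_mult_less_top)
next
  case (Suc t)
  let ?a = "\<lambda>\<omega>. (1 + Mc) * N (X t \<omega> - xs)" and ?b = "\<lambda>\<omega>. Mc * N xs + Mc * g (\<xi> t \<omega>)"
  have le: "N (X (Suc t) \<omega> - xs) \<le> ?a \<omega> + ?b \<omega>" for \<omega>
  proof -
    have "N (X (Suc t) \<omega> - xs) = N ((X t \<omega> - xs) - \<eta> t *\<^sub>R H (X t \<omega>) (\<xi> t \<omega>))" by (simp add: algebra_simps)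
    also have "\<dots> \<le> N (X t \<omega> - xs) + \<eta> t * N (H (X t \<omega>) (\<xi> t \<omega>))"
      using N_triangle_diff[of "X t \<omega> - xs" "\<eta> t *\<^sub>R H (X t \<omega>) (\<xi> t \<omega>)"] \<eta>_pos[of t] by (simp add: N_scaleR)
    also have "\<dots> \<le> N (X t \<omega> - xs) + 1 * N (H (X t \<omega>) (\<xi> t \<omega>))"
      using \<eta>_le_1[of t] by (intro add_left_mono mult_right_mono) auto
    also have "\<dots> \<le> N (X t \<omega> - xs) + 1 * (Mc * (N (X t \<omega>) + g (\<xi> t \<omega>)))"
      by (intro add_left_mono mult_left_mono growth) auto
    also have "\<dots> \<le> N (X t \<omega> - xs) + 1 * (Mc * ((N (X t \<omega> - xs) + N xs) + g (\<xi> t \<omega>)))"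
      using growth(1) N_triangle[of "X t \<omega> - xs" xs] by (intro add_left_mono mult_left_mono add_right_mono) auto
    finally show ?thesis by (simp add: algebra_simps)
  qed
  have "(\<integral>\<^sup>+\<omega>. ennreal (N (X (Suc t) \<omega> - xs) powr p) \<partial>M) \<le> (\<integral>\<^sup>+\<omega>. ennreal ((?a \<omega> + ?b \<omega>) powr p) \<partial>M)"
    using le p by (intro nn_integral_mono ennreal_leI powr_mono2) auto
  also have "\<dots> \<le> ennreal (2 powr p) * ((\<integral>\<^sup>+\<omega>. ennreal (?a \<omega> powr p) \<partial>M) + (\<integral>\<^sup>+\<omega>. ennreal (?b \<omega> powr p) \<partial>M))"
    using p growth(1) g(2) by (intro nn_integral_powr_add_le) auto
  also have "\<dots> < \<infinity>"
  proof -
    have "(\<integral>\<^sup>+\<omega>. ennreal (?a \<omega> powr p) \<partial>M) = ennreal ((1 + Mc) powr p) * (\<integral>\<^sup>+\<omega>. ennreal (N (X t \<omega> - xs) powr p) \<partial>M)"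
      using growth(1) by (subst nn_integral_cmult[symmetric]) (auto simp: powr_mult ennreal_mult)
    also have "\<dots> < \<infinity>" using Suc by (simp add: ennreal_mult_less_top)
    finally have a: "(\<integral>\<^sup>+\<omega>. ennreal (?a \<omega> powr p) \<partial>M) < \<infinity>" .
    have "(\<integral>\<^sup>+\<omega>. ennreal (?b \<omega> powr p) \<partial>M) \<le> ennreal (2 powr p) *
        ((\<integral>\<^sup>+\<omega>. ennreal ((Mc * N xs) powr p) \<partial>M) + (\<integral>\<^sup>+\<omega>. ennreal ((Mc * g (\<xi> t \<omega>)) powr p) \<partial>M))"
      using p growth(1) g(2) by (intro nn_integral_powr_add_le) auto
    also have "(\<integral>\<^sup>+\<omega>. ennreal ((Mc * g (\<xi> t \<omega>)) powr p) \<partial>M)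
        = ennreal (Mc powr p) * (\<integral>\<^sup>+\<omega>. ennreal (g (\<xi> t \<omega>) powr p) \<partial>M)"
      using growth(1) g(2) by (subst nn_integral_cmult[symmetric]) (auto simp: powr_mult ennreal_mult)
    also have "ennreal (2 powr p) * ((\<integral>\<^sup>+\<omega>. ennreal ((Mc * N xs) powr p) \<partial>M) + \<dots>) < \<infinity>"
      using le_less_trans[OF g_moment[of t] ennreal_less_top]
      by (simp add: ennreal_mult_less_top emeasure_space_1)
    finally have b: "(\<integral>\<^sup>+\<omega>. ennreal (?b \<omega> powr p) \<partial>M) < \<infinity>" .
    show ?thesis using a b by (simp add: ennreal_mult_less_top)
  qed
  finally show ?case .
qed

text \<open>
  The term \<open>h z - \<integral>h dK\<close> is the martingale part that the Poisson equation splits off the Markovian bias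
  \<open>PH xs (\<xi> n)\<close>; the remaining telescoping part is what \<open>w\<close> subtracts.
\<close>

definition noise :: "nat \<Rightarrow> 'w \<Rightarrow> 'a \<Rightarrow> 'b" where
  "noise n \<omega> z = H (X (Suc n) \<omega>) z - PH (X (Suc n) \<omega>) (\<xi> n \<omega>) + h z - (\<integral>z'. h z' \<partial>K (\<xi> n \<omega>))"

text \<open>Index \<open>n\<close> belongs to iterate \<open>Suc n\<close>, since
  \<open>\<xi> n\<close> is the last state used by that iterate. Setting \<open>u\<close> to zero up
  to \<open>n0\<close> lets the splitting begin once the steps are small.\<close>

primrec u :: "nat \<Rightarrow> nat \<Rightarrow> 'w \<Rightarrow> 'b" where
  "u n0 0 \<omega> = 0"
| "u n0 (Suc n) \<omega> = (if n < n0 then 0 else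
     (1 - c * \<eta> (Suc n)) *\<^sub>R u n0 n \<omega> - \<eta> (Suc n) *\<^sub>R noise n \<omega> (\<xi> (Suc n) \<omega>))"

text \<open>The Poisson equation leaves \<open>\<eta> (Suc n) *\<^sub>R h (\<xi> (Suc n))\<close> in
  the next iterate; subtracting it here replaces an error of order \<open>\<eta>\<close> by one of
  order \<open>\<eta>^2\<close>, made of the step decrement and a drift term.\<close>

definition w :: "nat \<Rightarrow> nat \<Rightarrow> 'w \<Rightarrow> 'b" where
  "w n0 n \<omega> = X (Suc n) \<omega> - xs - u n0 n \<omega> - \<eta> n *\<^sub>R h (\<xi> n \<omega>)"

lemma u_start: "u n n \<omega> = 0"
  by (cases n) auto

lemma noise_meas:
  "(\<lambda>(\<omega>, z). noise n \<omega> z) \<in> borel_measurable (hist_alg M \<xi> n \<Otimes>\<^sub>M borel)"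
proof -
  note X_hist_meas[of n, measurable]
  have [measurable]: "\<xi> n \<in> hist_alg M \<xi> n \<rightarrow>\<^sub>M borel" by (rule measurable_hist_alg) simp
  have [measurable]: "(\<lambda>z. \<integral>z'. h z' \<partial>K z) \<in> borel_measurable borel"
    by (rule measurable_compose[OF K_meas']) simp
  show ?thesis unfolding noise_def split_beta by measurable
qed

lemma u_hist_meas: "u n0 n \<in> borel_measurable (hist_alg M \<xi> n)"
proof (induction n)
  case 0
  show ?case by simp
next
  case (Suc n)
  have [measurable]: "u n0 n \<in> borel_measurable (hist_alg M \<xi> (Suc n))"
    by (rule measurable_hist_alg_Suc[OF Suc])
  have \<xi>[measurable]: "\<xi> (Suc n) \<in> hist_alg M \<xi> (Suc n) \<rightarrow>\<^sub>M borel" by (rule measurable_hist_alg) simp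
  have id: "(\<lambda>\<omega>. \<omega>) \<in> hist_alg M \<xi> (Suc n) \<rightarrow>\<^sub>M hist_alg M \<xi> n"
    by (rule measurable_hist_alg_Suc) simp
  have [measurable]: "(\<lambda>\<omega>. noise n \<omega> (\<xi> (Suc n) \<omega>)) \<in> borel_measurable (hist_alg M \<xi> (Suc n))"
    using measurable_compose[OF measurable_Pair[OF id \<xi>] noise_meas] by simp
  show ?case by (subst u.simps(2)[abs_def]) measurable
qed

lemma u_meas [measurable]: "u n0 n \<in> borel_measurable M"
  by (rule measurable_from_hist_alg[OF \<xi>_meas u_hist_meas])

lemma w_meas [measurable]: "w n0 n \<in> borel_measurable M"
  unfolding w_def by measurable

section \<open>Moment recursions for the two components\<close>

lemma PH_diff: "(\<integral>z'. H x z' - H y z' \<partial>K z) = PH x z - PH y z"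
  by (rule Bochner_Integration.integral_diff[OF H_intK H_intK])

lemma h_int: "integrable (K z) h"
proof -
  interpret Kz: prob_space "K z" by (rule K_prob)
  show ?thesis using h_bound by (intro Kz.integrable_const_bound[where B=D]) auto
qed

lemma D_nonneg: "0 \<le> D"
  using h_bound norm_ge_zero order_trans by blast

lemma noise_integral: "integrable (K (\<xi> n \<omega>)) (noise n \<omega>)" "(\<integral>z. noise n \<omega> z \<partial>K (\<xi> n \<omega>)) = 0"
proof -
  interpret Kz: prob_space "K (\<xi> n \<omega>)" by (rule K_prob)
  have [simp]: "integrable (K (\<xi> n \<omega>)) (H x)" "integrable (K (\<xi> n \<omega>)) h" for x
    by (rule H_intK h_int)+
  show "integrable (K (\<xi> n \<omega>)) (noise n \<omega>)" unfolding noise_def by simp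
  show "(\<integral>z. noise n \<omega> z \<partial>K (\<xi> n \<omega>)) = 0"
    unfolding noise_def by (simp add: Kz.prob_space)
qed

text \<open>The noise cancels against that in \<open>u\<close>. What remains is the linear drift,
  the expression bounded by (A7), and \<open>h\<close> with coefficient
  \<open>\<eta> n - \<eta> (Suc n) - c * \<eta> n * \<eta> (Suc n)\<close>.\<close>

lemma w_step:
  assumes "n0 \<le> n"
  shows "w n0 (Suc n) \<omega> = (1 - c * \<eta> (Suc n)) *\<^sub>R w n0 n \<omega>
    - \<eta> (Suc n) *\<^sub>R ((PH (X (Suc n) \<omega>) (\<xi> n \<omega>) - PH xs (\<xi> n \<omega>)) - c *\<^sub>R (X (Suc n) \<omega> - xs))
    + ((1 - c * \<eta> (Suc n)) * \<eta> n - \<eta> (Suc n)) *\<^sub>R h (\<xi> n \<omega>)"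
proof -
  have X2: "X (Suc (Suc n)) \<omega> = X (Suc n) \<omega> - \<eta> (Suc n) *\<^sub>R H (X (Suc n) \<omega>) (\<xi> (Suc n) \<omega>)"
    by (rule sa_iter.simps(2))
  have u2: "u n0 (Suc n) \<omega> = (1 - c * \<eta> (Suc n)) *\<^sub>R u n0 n \<omega> - \<eta> (Suc n) *\<^sub>R noise n \<omega> (\<xi> (Suc n) \<omega>)"
    using assms by simp
  show ?thesis
    unfolding w_def u2 X2 noise_def poisson
    by (simp add: algebra_simps del: sa_iter.simps)
qed

lemma X_decomp: "X (Suc n) \<omega> - xs = w n0 n \<omega> + u n0 n \<omega> + \<eta> n *\<^sub>R h (\<xi> n \<omega>)"
  by (simp add: w_def)

text \<open>Purely pathwise. Feeding the decomposition of \<open>X - xs\<close> into the contraction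
  term gives back \<open>\<gamma> * c\<close> times the size of \<open>w\<close>, so the net rate is
  \<open>(1 - \<gamma>) * c\<close>; the other contributions come from \<open>u\<close> and from the
  correction by \<open>h\<close>.\<close>

lemma w_powr_step:
  obtains C where "0 \<le> C"
    "\<And>n0 n \<omega>. \<lbrakk>n0 \<le> n; c * \<eta> (Suc n) \<le> 1; \<eta> (Suc n) \<le> \<eta> n; \<eta> n \<le> 2 * \<eta> (Suc n);
        \<eta> n - \<eta> (Suc n) \<le> 4 * (\<eta> (Suc n))\<^sup>2\<rbrakk> \<Longrightarrow>
      N (w n0 (Suc n) \<omega>) powr p \<le> (1 - (1 - \<gamma>) * c * \<eta> (Suc n)) * N (w n0 n \<omega>) powr p
        + C * \<eta> (Suc n) * norm (u n0 n \<omega>) powr p + C * \<eta> (Suc n) powr (p / 2 + 1)"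
proof -
  obtain A B where B: "0 < B" "\<And>x. N x \<le> B * norm x" using is_norm_equiv[OF norm] by metis
  define \<alpha> where "\<alpha> = (1 - \<gamma>) * c"
  have \<alpha>: "0 < \<alpha>" "\<alpha> \<le> c" and \<alpha>_eq: "\<alpha> = c - \<gamma> * c"
    using \<gamma> c by (auto simp: \<alpha>_def algebra_simps)
  define D' where "D' = B * D"
  have Nh: "N (h z) \<le> D'" for z
    using order_trans[OF B(2)[of "h z"] mult_left_mono[OF h_bound[of z], of B]] B(1) by (simp add: D'_def)
  have D'0: "0 \<le> D'" using Nh N_nonneg order_trans by blast
  \<comment> \<open>Division by \<open>\<alpha>\<close> in \<open>a\<close> and \<open>b\<close>
    lets the perturbation carry the weight \<open>\<alpha> * y\<close>, making the bound a convex
    combination of \<open>W\<close> and \<open>a * U + b * y\<close>. In \<open>b\<close>,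
    \<open>4 + 2 * c\<close> is the coefficient of \<open>h\<close> in the step and
    \<open>2 * \<gamma> * c\<close> comes from \<open>h\<close> inside the error.\<close>
  define a where "a = \<gamma> * c * B / \<alpha>"
  define b where "b = (4 + 2 * c + 2 * \<gamma> * c) * D' / \<alpha>"
  have ab: "0 \<le> a" "0 \<le> b" using \<gamma> c B \<alpha> D'0 by (auto simp: a_def b_def)
  define C where "C = \<alpha> * 2 powr p * (a powr p + b powr p)"
  show thesis
  proof
    show "0 \<le> C" using \<alpha> by (simp add: C_def)
    fix n0 n :: nat and \<omega>
    assume n: "n0 \<le> n"
    define x y where "x = \<eta> n" and "y = \<eta> (Suc n)"
    assume "c * \<eta> (Suc n) \<le> 1" "\<eta> (Suc n) \<le> \<eta> n" "\<eta> n \<le> 2 * \<eta> (Suc n)" "\<eta> n - \<eta> (Suc n) \<le> 4 * (\<eta> (Suc n))\<^sup>2"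
    then have cy: "c * y \<le> 1" and yx: "y \<le> x" "x \<le> 2 * y" "x - y \<le> 4 * y\<^sup>2" by (simp_all add: x_def y_def)
    have y: "0 < y" "y \<le> 1" using \<eta>_pos \<eta>_le_1 by (simp_all add: y_def)
    have \<alpha>y: "\<alpha> * y \<le> 1" using mult_right_mono[OF \<alpha>(2), of y] y cy by linarith
    define e where "e = X (Suc n) \<omega> - xs"
    define W where "W = N (w n0 n \<omega>)"
    define U where "U = norm (u n0 n \<omega>)"
    have WU: "0 \<le> W" "0 \<le> U" by (simp_all add: W_def U_def)
    have Ne: "N e \<le> W + B * U + 2 * y * D'"
    proof -
      have "N e \<le> N (w n0 n \<omega> + u n0 n \<omega>) + N (x *\<^sub>R h (\<xi> n \<omega>))"
        unfolding e_def X_decomp[of n \<omega> n0] x_def by (rule N_triangle)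
      also have "\<dots> \<le> (N (w n0 n \<omega>) + N (u n0 n \<omega>)) + x * N (h (\<xi> n \<omega>))"
        using yx y by (intro add_mono N_triangle) (simp add: N_scaleR)
      also have "\<dots> \<le> (W + B * U) + 2 * y * D'"
        unfolding W_def U_def using yx y Nh D'0 by (intro add_mono mult_mono B order_refl) auto
      finally show ?thesis .
    qed
    have "N (w n0 (Suc n) \<omega>) \<le> (1 - c * y) * W + y * (\<gamma> * c * N e) + (4 * y\<^sup>2 + 2 * c * y\<^sup>2) * D'"
    proof -
      let ?t = "(PH (X (Suc n) \<omega>) (\<xi> n \<omega>) - PH xs (\<xi> n \<omega>)) - c *\<^sub>R e"
      have "N (w n0 (Suc n) \<omega>) \<le> N ((1 - c * y) *\<^sub>R w n0 n \<omega> - y *\<^sub>R ?t) + N (((1 - c * y) * x - y) *\<^sub>R h (\<xi> n \<omega>))"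
        unfolding w_step[OF n] x_def y_def e_def by (rule N_triangle)
      also have "\<dots> \<le> (N ((1 - c * y) *\<^sub>R w n0 n \<omega>) + N (y *\<^sub>R ?t)) + N (((1 - c * y) * x - y) *\<^sub>R h (\<xi> n \<omega>))"
        by (intro add_right_mono N_triangle_diff)
      also have "\<dots> = ((1 - c * y) * W + y * N ?t) + \<bar>(1 - c * y) * x - y\<bar> * N (h (\<xi> n \<omega>))"
        using cy y by (simp add: N_scaleR W_def)
      also have "\<dots> \<le> ((1 - c * y) * W + y * (\<gamma> * c * N e)) + (4 * y\<^sup>2 + 2 * c * y\<^sup>2) * D'"
      proof (intro add_mono mult_mono mult_left_mono order_refl)
        show "N ?t \<le> \<gamma> * c * N e"
          using contraction[where x="X (Suc n) \<omega>" and y=xs and z="\<xi> n \<omega>"] unfolding PH_diff e_def .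
        have "c * (x * y) \<le> c * (2 * y * y)" using yx c y by (intro mult_left_mono mult_right_mono) auto
        moreover have "0 \<le> c * (x * y)" using c y yx by simp
        moreover have "(1 - c * y) * x - y = (x - y) - c * (x * y)" by (simp add: algebra_simps)
        ultimately show "\<bar>(1 - c * y) * x - y\<bar> \<le> 4 * y\<^sup>2 + 2 * c * y\<^sup>2"
          using yx by (simp add: power2_eq_square abs_le_iff)
      qed (use y Nh c cy WU in auto)
      finally show ?thesis .
    qed
    also have "\<dots> \<le> (1 - c * y) * W + y * (\<gamma> * c * (W + B * U + 2 * y * D')) + (4 * y\<^sup>2 + 2 * c * y\<^sup>2) * D'"
      using y \<gamma> c Ne by (intro add_right_mono add_left_mono mult_left_mono) auto
    also have "\<dots> = (1 - \<alpha> * y) * W + y * (\<gamma> * c * B * U + (4 + 2 * c + 2 * \<gamma> * c) * D' * y)"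
      unfolding \<alpha>_eq by (simp add: algebra_simps power2_eq_square)
    also have "\<dots> = (1 - \<alpha> * y) * W + (\<alpha> * y) * (a * U + b * y)"
      using \<alpha>(1) by (simp add: a_def b_def field_simps)
    finally have "N (w n0 (Suc n) \<omega>) powr p \<le> ((1 - \<alpha> * y) * W + (\<alpha> * y) * (a * U + b * y)) powr p"
      using p by (intro powr_mono2) auto
    also have "\<dots> \<le> (1 - \<alpha> * y) * W powr p + (\<alpha> * y) * (a * U + b * y) powr p"
      using p \<alpha> y WU ab \<alpha>y by (intro powr_convex_combination) auto
    also have "\<dots> \<le> (1 - \<alpha> * y) * W powr p + (\<alpha> * y) * (2 powr p * ((a * U) powr p + (b * y) powr p))"
      using ab y WU \<alpha> p by (intro add_left_mono mult_left_mono powr_add_le) auto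
    also have "\<dots> = (1 - \<alpha> * y) * W powr p + (\<alpha> * 2 powr p * a powr p) * (y * U powr p) + (\<alpha> * 2 powr p * b powr p) * (y * y powr p)"
      using ab y WU by (simp add: powr_mult algebra_simps)
    also have "\<dots> \<le> (1 - \<alpha> * y) * W powr p + C * (y * U powr p) + C * y powr (p / 2 + 1)"
    proof (intro add_mono mult_mono order_refl)
      show "\<alpha> * 2 powr p * a powr p \<le> C" "\<alpha> * 2 powr p * b powr p \<le> C"
        using \<alpha> by (auto simp: C_def intro!: mult_left_mono)
      have "y * y powr p = y powr (p + 1)" using y by (simp add: powr_add)
      also have "\<dots> \<le> y powr (p / 2 + 1)" using y p by (intro powr_mono') auto
      finally show "y * y powr p \<le> y powr (p / 2 + 1)" .
    qed (use y \<open>0 \<le> C\<close> \<alpha>y in auto)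
    finally show "N (w n0 (Suc n) \<omega>) powr p \<le> (1 - (1 - \<gamma>) * c * \<eta> (Suc n)) * N (w n0 n \<omega>) powr p
        + C * \<eta> (Suc n) * norm (u n0 n \<omega>) powr p + C * \<eta> (Suc n) powr (p / 2 + 1)"
      by (simp add: \<alpha>_def y_def W_def U_def mult.assoc)
  qed
qed

lemma norm_integral_h: "norm (\<integral>z'. h z' \<partial>K z) \<le> D"
proof -
  interpret Kz: prob_space "K z" by (rule K_prob)
  have "norm (\<integral>z'. h z' \<partial>K z) \<le> (\<integral>z'. norm (h z') \<partial>K z)" by (rule integral_norm_bound)
  also have "\<dots> \<le> (\<integral>z'. D \<partial>K z)" using h_int h_bound by (intro integral_mono) auto
  finally show ?thesis by (simp add: Kz.prob_space)
qed

text \<open>The growth condition bounds \<open>H\<close>; for \<open>PH\<close>, contraction around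
  \<open>xs\<close> is used, with \<open>PH xs\<close> bounded by \<open>2 * D\<close> through the
  Poisson equation. The integral of \<open>g\<close> under \<open>K\<close> is left as it stands,
  because its expectation is a moment of \<open>g\<close> at the next state.\<close>

lemma noise_moment:
  obtains C where "0 \<le> C"
    "\<And>n \<omega>. (\<integral>\<^sup>+z. ennreal (norm (noise n \<omega> z) powr p) \<partial>K (\<xi> n \<omega>))
      \<le> ennreal C * (1 + ennreal (N (X (Suc n) \<omega> - xs) powr p) + (\<integral>\<^sup>+z. ennreal (g z powr p) \<partial>K (\<xi> n \<omega>)))"
proof -
  obtain A B where A: "0 < A" "\<And>x. norm x \<le> A * N x" using is_norm_equiv[OF norm] by metis
  define R where "R = (A * Mc + 2 * A * c) + (A * Mc * N xs + 4 * D) + A * Mc"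
  have coeffs: "0 \<le> A * Mc + 2 * A * c" "0 \<le> A * Mc * N xs + 4 * D" "0 \<le> A * Mc"
    using A growth(1) c D_nonneg by auto
  then have R0: "0 \<le> R" unfolding R_def by linarith
  define C where "C = R powr p * (2 powr p * 2 powr p)"
  have pt: "norm (noise n \<omega> z) powr p \<le> C * (1 + N (X (Suc n) \<omega> - xs) powr p + g z powr p)" for n \<omega> z
  proof -
    define x where "x = X (Suc n) \<omega>"
    define e where "e = N (x - xs)"
    define z0 where "z0 = \<xi> n \<omega>"
    have e0: "0 \<le> e" by (simp add: e_def)
    have "norm (H x z) \<le> A * (Mc * (N x + g z))"
      using A(2)[of "H x z"] mult_left_mono[OF growth(2)[where x=x and z=z], of A] A(1) by linarith
    also have "\<dots> \<le> A * (Mc * ((e + N xs) + g z))"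
      using A growth(1) N_triangle[of "x - xs" xs] by (intro mult_left_mono add_right_mono) (auto simp: e_def)
    finally have 1: "norm (H x z) \<le> A * Mc * e + A * Mc * N xs + A * Mc * g z" by (simp add: algebra_simps)
    have 2: "norm (PH x z0) \<le> 2 * A * c * e + 2 * D"
    proof -
      have "N (PH x z0 - PH xs z0) \<le> N ((PH x z0 - PH xs z0) - c *\<^sub>R (x - xs)) + N (c *\<^sub>R (x - xs))"
        using N_triangle[of "(PH x z0 - PH xs z0) - c *\<^sub>R (x - xs)" "c *\<^sub>R (x - xs)"] by simp
      also have "\<dots> \<le> \<gamma> * c * e + c * e"
        using contraction[where x=x and y=xs and z=z0] c unfolding PH_diff by (intro add_mono) (auto simp: e_def N_scaleR)
      also have "\<dots> \<le> 2 * c * e" using mult_right_mono[of \<gamma> 1 "c * e"] \<gamma> c e0 by simp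
      finally have "norm (PH x z0 - PH xs z0) \<le> A * (2 * c * e)"
        using A(2)[of "PH x z0 - PH xs z0"] A(1) by (meson mult_left_mono less_imp_le order_trans)
      moreover have "norm (PH xs z0) \<le> 2 * D"
      proof -
        have "PH xs z0 = h z0 - (\<integral>z'. h z' \<partial>K z0)" by (simp add: poisson)
        then show ?thesis
          using norm_triangle_ineq4[of "h z0" "\<integral>z'. h z' \<partial>K z0"] h_bound[of z0] norm_integral_h[of z0] by simp
      qed
      ultimately show ?thesis using norm_triangle_ineq[of "PH x z0 - PH xs z0" "PH xs z0"] by simp
    qed
    have "norm (v1 - v2 + v3 - v4) \<le> norm v1 + norm v2 + norm v3 + norm v4" for v1 v2 v3 v4 :: 'b by norm
    then have "norm (noise n \<omega> z) \<le> norm (H x z) + norm (PH x z0) + norm (h z) + norm (\<integral>z'. h z' \<partial>K z0)"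
      unfolding noise_def x_def z0_def .
    also have "\<dots> \<le> (A * Mc + 2 * A * c) * e + (A * Mc * N xs + 4 * D) * 1 + A * Mc * g z"
      using 1 2 h_bound[of z] norm_integral_h[of z0] by (simp add: algebra_simps)
    also have "\<dots> \<le> R * e + R * 1 + R * g z"
      using coeffs e0 g(2)[of z] by (intro add_mono mult_right_mono) (auto simp: R_def)
    also have "\<dots> = R * ((1 + e) + g z)" by (simp add: algebra_simps)
    finally have "norm (noise n \<omega> z) powr p \<le> (R * ((1 + e) + g z)) powr p"
      using p by (intro powr_mono2) auto
    also have "\<dots> = R powr p * ((1 + e) + g z) powr p" using R0 e0 g(2)[of z] by (simp add: powr_mult)
    also have "\<dots> \<le> R powr p * (2 powr p * ((1 + e) powr p + g z powr p))"
      using p e0 g(2)[of z] by (intro mult_left_mono powr_add_le) auto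
    also have "\<dots> \<le> R powr p * (2 powr p * (2 powr p * (1 powr p + e powr p) + 2 powr p * g z powr p))"
    proof -
      have "(1 + e) powr p \<le> 2 powr p * (1 powr p + e powr p)" using p e0 by (intro powr_add_le) auto
      moreover have "1 * g z powr p \<le> 2 powr p * g z powr p" using p by (intro mult_right_mono ge_one_powr_ge_zero) auto
      ultimately show ?thesis by (intro mult_left_mono add_mono) auto
    qed
    also have "\<dots> = C * (1 + e powr p + g z powr p)" by (simp add: C_def algebra_simps)
    finally show ?thesis by (simp add: e_def x_def)
  qed
  have C0: "0 \<le> C" by (simp add: C_def)
  show thesis
  proof (rule that[OF C0])
    fix n \<omega>
    interpret Kz: prob_space "K (\<xi> n \<omega>)" by (rule K_prob)
    have "(\<integral>\<^sup>+z. ennreal (norm (noise n \<omega> z) powr p) \<partial>K (\<xi> n \<omega>))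
       \<le> (\<integral>\<^sup>+z. ennreal C * ((1 + ennreal (N (X (Suc n) \<omega> - xs) powr p)) + ennreal (g z powr p)) \<partial>K (\<xi> n \<omega>))"
      using pt[of n \<omega>] C0 by (intro nn_integral_mono)
        (simp flip: ennreal_plus ennreal_mult ennreal_1 add: ennreal_leI del: sa_iter.simps)
    also have "\<dots> = ennreal C * (1 + ennreal (N (X (Suc n) \<omega> - xs) powr p) + (\<integral>\<^sup>+z. ennreal (g z powr p) \<partial>K (\<xi> n \<omega>)))"
      by (simp add: nn_integral_cmult nn_integral_add Kz.emeasure_space_1 del: sa_iter.simps)
    finally show "(\<integral>\<^sup>+z. ennreal (norm (noise n \<omega> z) powr p) \<partial>K (\<xi> n \<omega>)) \<le> \<dots>" .
  qed
qed

text \<open>Conditioning on the past reduces the claim to the one-step inequality with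
  \<open>\<epsilon> = c / 2\<close>. Its loss \<open>1 + c / 2 * y\<close> costs half of the drift:
  \<open>(1 + c / 2 * y) * (1 - c * y)\<close> is at most \<open>1 - c / 2 * y\<close>.\<close>

lemma u_powr_step:
  obtains C where "0 \<le> C"
    "\<And>n0 n. \<lbrakk>n0 \<le> n; c * \<eta> (Suc n) \<le> 1\<rbrakk> \<Longrightarrow>
      (\<integral>\<^sup>+\<omega>. ennreal (norm (u n0 (Suc n) \<omega>) powr p) \<partial>M)
       \<le> ennreal (1 - c / 2 * \<eta> (Suc n)) * (\<integral>\<^sup>+\<omega>. ennreal (norm (u n0 n \<omega>) powr p) \<partial>M)
        + ennreal (C * \<eta> (Suc n) powr (p / 2 + 1)) * (1 + (\<integral>\<^sup>+\<omega>. ennreal (N (X (Suc n) \<omega> - xs) powr p) \<partial>M))"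
proof -
  obtain C1 where C1: "0 < C1" "\<And>(Q :: 'a measure) (m :: 'a \<Rightarrow> 'b) a \<eta>.
      \<lbrakk>prob_space Q; integrable Q m; (\<integral>z. m z \<partial>Q) = 0; 0 < \<eta>; \<eta> \<le> 1\<rbrakk> \<Longrightarrow>
      (\<integral>\<^sup>+z. ennreal (norm (a - \<eta> *\<^sub>R m z) powr p) \<partial>Q)
        \<le> ennreal ((1 + c / 2 * \<eta>) * norm a powr p)
          + ennreal (C1 * \<eta> powr (p / 2 + 1)) * (\<integral>\<^sup>+z. ennreal (norm (m z) powr p) \<partial>Q)"
    using nn_integral_norm_powr_step[OF p, of "c / 2", where 'a='a and 'b='b] c by auto
  obtain C2 where C2: "0 \<le> C2" "\<And>n \<omega>. (\<integral>\<^sup>+z. ennreal (norm (noise n \<omega> z) powr p) \<partial>K (\<xi> n \<omega>))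
      \<le> ennreal C2 * (1 + ennreal (N (X (Suc n) \<omega> - xs) powr p) + (\<integral>\<^sup>+z. ennreal (g z powr p) \<partial>K (\<xi> n \<omega>)))"
    using noise_moment by metis
  \<comment> \<open>No sign of \<open>G\<close> is assumed, hence the absolute value.\<close>
  define C where "C = C1 * C2 * (1 + \<bar>G\<bar>)"
  show thesis
  proof
    show "0 \<le> C" using C1 C2 by (simp add: C_def)
    fix n0 n assume n: "n0 \<le> n" and cy': "c * \<eta> (Suc n) \<le> 1"
    define y where "y = \<eta> (Suc n)"
    have y: "0 < y" "y \<le> 1" "c * y \<le> 1" using \<eta>_pos \<eta>_le_1 cy' by (simp_all add: y_def)
    let ?U = "\<integral>\<^sup>+\<omega>. ennreal (norm (u n0 n \<omega>) powr p) \<partial>M"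
    let ?E = "\<integral>\<^sup>+\<omega>. ennreal (N (X (Suc n) \<omega> - xs) powr p) \<partial>M"
    let ?c = "C1 * y powr (p / 2 + 1)"
    let ?Kg = "\<lambda>\<omega>. \<integral>\<^sup>+z. ennreal (g z powr p) \<partial>K (\<xi> n \<omega>)"
    have Kg_meas[measurable]: "?Kg \<in> borel_measurable M"
      by (rule measurable_compose[OF \<xi>_meas], rule measurable_compose[OF K_meas']) measurable
    have Kg: "(\<integral>\<^sup>+\<omega>. ?Kg \<omega> \<partial>M) \<le> ennreal \<bar>G\<bar>"
    proof -
      have "(\<integral>\<^sup>+\<omega>. ?Kg \<omega> \<partial>M) = (\<integral>\<^sup>+\<omega>. ennreal (g (\<xi> (Suc n) \<omega>) powr p) \<partial>M)"
        by (rule markov_chain_nn_integral[OF chain, symmetric]) measurable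
      also have "\<dots> \<le> ennreal \<bar>G\<bar>" using g_moment[of "Suc n"] by (rule order_trans) (simp add: ennreal_leI)
      finally show ?thesis .
    qed
    define a where "a \<omega> = (1 - c * y) *\<^sub>R u n0 n \<omega>" for \<omega>
    have "(\<integral>\<^sup>+\<omega>. ennreal (norm (u n0 (Suc n) \<omega>) powr p) \<partial>M)
        = (\<integral>\<^sup>+\<omega>. ennreal (norm (a \<omega> - y *\<^sub>R noise n \<omega> (\<xi> (Suc n) \<omega>)) powr p) \<partial>M)"
      using n by (simp add: a_def y_def)
    also have "\<dots> = (\<integral>\<^sup>+\<omega>. \<integral>\<^sup>+z. ennreal (norm (a \<omega> - y *\<^sub>R noise n \<omega> z) powr p) \<partial>K (\<xi> n \<omega>) \<partial>M)"
    proof (rule markov_chain_nn_integral[OF chain])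
      note u_hist_meas[of n0 n, measurable] noise_meas[of n, unfolded split_beta, measurable]
      show "(\<lambda>(\<omega>, z). ennreal (norm (a \<omega> - y *\<^sub>R noise n \<omega> z) powr p)) \<in> borel_measurable (hist_alg M \<xi> n \<Otimes>\<^sub>M borel)"
        unfolding a_def split_beta by measurable
    qed
    also have "\<dots> \<le> (\<integral>\<^sup>+\<omega>. ennreal (1 - c / 2 * y) * ennreal (norm (u n0 n \<omega>) powr p)
        + ennreal (?c * C2) * ((1 + ennreal (N (X (Suc n) \<omega> - xs) powr p)) + ?Kg \<omega>) \<partial>M)"
    proof (rule nn_integral_mono)
      fix \<omega>
      have "(\<integral>\<^sup>+z. ennreal (norm (a \<omega> - y *\<^sub>R noise n \<omega> z) powr p) \<partial>K (\<xi> n \<omega>))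
         \<le> ennreal ((1 + c / 2 * y) * norm (a \<omega>) powr p)
          + ennreal ?c * (\<integral>\<^sup>+z. ennreal (norm (noise n \<omega> z) powr p) \<partial>K (\<xi> n \<omega>))"
        by (rule C1(2)[OF K_prob noise_integral y(1,2)])
      also have "\<dots> \<le> ennreal ((1 - c / 2 * y) * norm (u n0 n \<omega>) powr p)
          + ennreal ?c * (ennreal C2 * (1 + ennreal (N (X (Suc n) \<omega> - xs) powr p) + ?Kg \<omega>))"
      proof (intro add_mono ennreal_leI mult_left_mono C2)
        have "norm (a \<omega>) powr p = (1 - c * y) powr p * norm (u n0 n \<omega>) powr p"
          using y by (simp add: a_def powr_mult)
        also have "\<dots> \<le> (1 - c * y) powr 1 * norm (u n0 n \<omega>) powr p"
          using y c p by (intro mult_right_mono powr_mono') auto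
        also have "\<dots> = (1 - c * y) * norm (u n0 n \<omega>) powr p" using y by simp
        finally have "(1 + c / 2 * y) * norm (a \<omega>) powr p \<le> (1 + c / 2 * y) * ((1 - c * y) * norm (u n0 n \<omega>) powr p)"
          using y c by (intro mult_left_mono) auto
        also have "\<dots> = ((1 - c / 2 * y) - (c * y) * (c * y) / 2) * norm (u n0 n \<omega>) powr p"
          by (simp add: field_simps)
        also have "\<dots> \<le> (1 - c / 2 * y) * norm (u n0 n \<omega>) powr p"
          by (intro mult_right_mono) auto
        finally show "(1 + c / 2 * y) * norm (a \<omega>) powr p \<le> (1 - c / 2 * y) * norm (u n0 n \<omega>) powr p" .
      qed simp
      also have "\<dots> = ennreal (1 - c / 2 * y) * ennreal (norm (u n0 n \<omega>) powr p)
        + ennreal (?c * C2) * ((1 + ennreal (N (X (Suc n) \<omega> - xs) powr p)) + ?Kg \<omega>)"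
        using y c C1 C2(1) by (simp add: ennreal_mult ennreal_mult' mult.assoc del: sa_iter.simps)
      finally show "(\<integral>\<^sup>+z. ennreal (norm (a \<omega> - y *\<^sub>R noise n \<omega> z) powr p) \<partial>K (\<xi> n \<omega>)) \<le> \<dots>" .
    qed
    also have "\<dots> = ennreal (1 - c / 2 * y) * ?U + ennreal (?c * C2) * ((1 + ?E) + (\<integral>\<^sup>+\<omega>. ?Kg \<omega> \<partial>M))"
      by (simp add: nn_integral_add nn_integral_cmult emeasure_space_1 del: sa_iter.simps)
    also have "\<dots> \<le> ennreal (1 - c / 2 * y) * ?U + ennreal (?c * C2) * (ennreal (1 + \<bar>G\<bar>) * (1 + ?E))"
    proof (intro add_left_mono mult_left_mono)
      have "(1 + ?E) + (\<integral>\<^sup>+\<omega>. ?Kg \<omega> \<partial>M) \<le> (1 + ?E) + ennreal \<bar>G\<bar> * (1 + ?E)"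
        using Kg by (intro add_left_mono order_trans[OF Kg]) (simp add: distrib_left)
      also have "\<dots> = ennreal (1 + \<bar>G\<bar>) * (1 + ?E)"
        by (simp add: distrib_right ennreal_plus)
      finally show "(1 + ?E) + (\<integral>\<^sup>+\<omega>. ?Kg \<omega> \<partial>M) \<le> ennreal (1 + \<bar>G\<bar>) * (1 + ?E)" .
    qed simp
    also have "\<dots> = ennreal (1 - c / 2 * y) * ?U + ennreal (C * y powr (p / 2 + 1)) * (1 + ?E)"
    proof -
      have "ennreal (C * y powr (p / 2 + 1)) = ennreal (?c * C2) * ennreal (1 + \<bar>G\<bar>)"
        using C1 C2(1) by (subst ennreal_mult[symmetric]) (auto simp: C_def algebra_simps)
      then show ?thesis by (simp only: mult.assoc)
    qed
    finally show "(\<integral>\<^sup>+\<omega>. ennreal (norm (u n0 (Suc n) \<omega>) powr p) \<partial>M)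
       \<le> ennreal (1 - c / 2 * \<eta> (Suc n)) * ?U + ennreal (C * \<eta> (Suc n) powr (p / 2 + 1)) * (1 + ?E)"
      unfolding y_def .
  qed
qed

text \<open>Serves twice: it closes the feedback of the iterate into the noise, and it finally
  converts bounds on \<open>u\<close> and \<open>w\<close> into one on the iterates.
  \<open>R\<close> dominates the coefficients 1, \<open>B\<close> and \<open>B * D\<close> of the
  three components.\<close>

lemma X_moment_decomp:
  obtains C where "0 \<le> C"
    "\<And>n0 n. (\<integral>\<^sup>+\<omega>. ennreal (N (X (Suc n) \<omega> - xs) powr p) \<partial>M)
      \<le> ennreal C * ((\<integral>\<^sup>+\<omega>. ennreal (norm (u n0 n \<omega>) powr p) \<partial>M) + (\<integral>\<^sup>+\<omega>. ennreal (N (w n0 n \<omega>) powr p) \<partial>M)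
        + ennreal (\<eta> n powr p))"
proof -
  obtain A B where B: "0 < B" "\<And>x. N x \<le> B * norm x" using is_norm_equiv[OF norm] by metis
  define R where "R = 1 + B + B * D"
  have R: "1 \<le> R" "B \<le> R" "B * D \<le> R" using B D_nonneg by (auto simp: R_def)
  define C where "C = R powr p * (2 powr p * 2 powr p)"
  have C0: "0 \<le> C" by (simp add: C_def)
  have pt: "N (X (Suc n) \<omega> - xs) powr p \<le> C * (norm (u n0 n \<omega>) powr p + N (w n0 n \<omega>) powr p + \<eta> n powr p)" for n0 n \<omega>
  proof -
    have hn: "N (\<eta> n *\<^sub>R h (\<xi> n \<omega>)) \<le> R * \<eta> n"
    proof -
      have "N (\<eta> n *\<^sub>R h (\<xi> n \<omega>)) = \<eta> n * N (h (\<xi> n \<omega>))" using \<eta>_pos[of n] by (simp add: N_scaleR)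
      also have "\<dots> \<le> \<eta> n * (B * D)"
        using \<eta>_pos[of n] B(2)[of "h (\<xi> n \<omega>)"] mult_left_mono[OF h_bound[of "\<xi> n \<omega>"], of B] B(1)
        by (intro mult_left_mono) linarith+
      also have "\<dots> \<le> \<eta> n * R" using R \<eta>_pos[of n] by (intro mult_left_mono) auto
      finally show ?thesis by (simp add: mult.commute)
    qed
    have "N (X (Suc n) \<omega> - xs) \<le> N (w n0 n \<omega>) + N (u n0 n \<omega>) + N (\<eta> n *\<^sub>R h (\<xi> n \<omega>))"
      unfolding X_decomp[of n \<omega> n0] using N_triangle order_trans add_right_mono by meson
    also have "\<dots> \<le> R * N (w n0 n \<omega>) + R * norm (u n0 n \<omega>) + R * \<eta> n"
      using R(1) mult_right_mono[OF R(1), of "N (w n0 n \<omega>)"] B(2)[of "u n0 n \<omega>"]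
        mult_right_mono[OF R(2), of "norm (u n0 n \<omega>)"] hn by (intro add_mono) auto
    also have "\<dots> = R * ((norm (u n0 n \<omega>) + N (w n0 n \<omega>)) + \<eta> n)" by (simp add: algebra_simps)
    finally have "N (X (Suc n) \<omega> - xs) powr p \<le> (R * ((norm (u n0 n \<omega>) + N (w n0 n \<omega>)) + \<eta> n)) powr p"
      using p by (intro powr_mono2) auto
    also have "\<dots> = R powr p * ((norm (u n0 n \<omega>) + N (w n0 n \<omega>)) + \<eta> n) powr p"
      using R \<eta>_pos[of n] by (subst powr_mult) auto
    also have "\<dots> \<le> R powr p * (2 powr p * ((norm (u n0 n \<omega>) + N (w n0 n \<omega>)) powr p + \<eta> n powr p))"
      using p \<eta>_pos[of n] by (intro mult_left_mono powr_add_le) auto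
    also have "\<dots> \<le> R powr p * (2 powr p * (2 powr p * (norm (u n0 n \<omega>) powr p + N (w n0 n \<omega>) powr p) + 2 powr p * \<eta> n powr p))"
    proof -
      have "(norm (u n0 n \<omega>) + N (w n0 n \<omega>)) powr p \<le> 2 powr p * (norm (u n0 n \<omega>) powr p + N (w n0 n \<omega>) powr p)"
        using p by (intro powr_add_le) auto
      moreover have "1 * \<eta> n powr p \<le> 2 powr p * \<eta> n powr p"
        using p by (intro mult_right_mono ge_one_powr_ge_zero) auto
      ultimately show ?thesis by (intro mult_left_mono add_mono) auto
    qed
    also have "\<dots> = C * (norm (u n0 n \<omega>) powr p + N (w n0 n \<omega>) powr p + \<eta> n powr p)"
      by (simp add: C_def algebra_simps)
    finally show ?thesis .
  qed
  show thesis
  proof (rule that[OF C0])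
    fix n0 n
    have "(\<integral>\<^sup>+\<omega>. ennreal (N (X (Suc n) \<omega> - xs) powr p) \<partial>M)
        \<le> (\<integral>\<^sup>+\<omega>. ennreal C * ((ennreal (norm (u n0 n \<omega>) powr p) + ennreal (N (w n0 n \<omega>) powr p)) + ennreal (\<eta> n powr p)) \<partial>M)"
      using pt[of n _ n0] C0 by (intro nn_integral_mono)
        (simp flip: ennreal_plus ennreal_mult add: ennreal_leI del: sa_iter.simps)
    also have "\<dots> = ennreal C * ((\<integral>\<^sup>+\<omega>. ennreal (norm (u n0 n \<omega>) powr p) \<partial>M) + (\<integral>\<^sup>+\<omega>. ennreal (N (w n0 n \<omega>) powr p) \<partial>M)
        + ennreal (\<eta> n powr p))"
      by (simp add: nn_integral_add nn_integral_cmult emeasure_space_1)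
    finally show "(\<integral>\<^sup>+\<omega>. ennreal (N (X (Suc n) \<omega> - xs) powr p) \<partial>M) \<le> \<dots>" .
  qed
qed

section \<open>Combined moment recursion and the resulting rate\<close>

definition U_mom :: "nat \<Rightarrow> nat \<Rightarrow> ennreal" where
  "U_mom n0 n = (\<integral>\<^sup>+\<omega>. ennreal (norm (u n0 n \<omega>) powr p) \<partial>M)"

definition W_mom :: "nat \<Rightarrow> nat \<Rightarrow> ennreal" where
  "W_mom n0 n = (\<integral>\<^sup>+\<omega>. ennreal (N (w n0 n \<omega>) powr p) \<partial>M)"

text \<open>
  The moment of \<open>u\<close> enters the recursion of \<open>w\<close> with a coefficient of order \<open>\<eta>\<close>, the order of its own
  decay rate, so weighting it by a large constant \<open>A\<close> absorbs this coupling.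
\<close>

lemma drift:
  obtains A \<mu> C \<theta> where "0 < A" "0 < \<mu>" "0 \<le> C" "0 < \<theta>"
    "\<And>n0 n r. \<lbrakk>n0 \<le> n; \<eta> (Suc n) \<le> \<theta>; \<eta> (Suc n) \<le> \<eta> n; \<eta> n \<le> 2 * \<eta> (Suc n);
        \<eta> n - \<eta> (Suc n) \<le> 4 * (\<eta> (Suc n))\<^sup>2; 0 \<le> r; ennreal A * U_mom n0 n + W_mom n0 n \<le> ennreal r\<rbrakk> \<Longrightarrow>
      ennreal A * U_mom n0 (Suc n) + W_mom n0 (Suc n)
        \<le> ennreal ((1 - \<mu> * \<eta> (Suc n)) * r + C * \<eta> (Suc n) powr (p / 2 + 1))"
proof -
  obtain C4 where C4: "0 \<le> C4"
    "\<And>n0 n \<omega>. \<lbrakk>n0 \<le> n; c * \<eta> (Suc n) \<le> 1; \<eta> (Suc n) \<le> \<eta> n; \<eta> n \<le> 2 * \<eta> (Suc n);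
        \<eta> n - \<eta> (Suc n) \<le> 4 * (\<eta> (Suc n))\<^sup>2\<rbrakk> \<Longrightarrow>
      N (w n0 (Suc n) \<omega>) powr p \<le> (1 - (1 - \<gamma>) * c * \<eta> (Suc n)) * N (w n0 n \<omega>) powr p
        + C4 * \<eta> (Suc n) * norm (u n0 n \<omega>) powr p + C4 * \<eta> (Suc n) powr (p / 2 + 1)"
    using w_powr_step by metis
  obtain C5 where C5: "0 \<le> C5"
    "\<And>n0 n. \<lbrakk>n0 \<le> n; c * \<eta> (Suc n) \<le> 1\<rbrakk> \<Longrightarrow>
      (\<integral>\<^sup>+\<omega>. ennreal (norm (u n0 (Suc n) \<omega>) powr p) \<partial>M)
       \<le> ennreal (1 - c / 2 * \<eta> (Suc n)) * (\<integral>\<^sup>+\<omega>. ennreal (norm (u n0 n \<omega>) powr p) \<partial>M)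
        + ennreal (C5 * \<eta> (Suc n) powr (p / 2 + 1)) * (1 + (\<integral>\<^sup>+\<omega>. ennreal (N (X (Suc n) \<omega> - xs) powr p) \<partial>M))"
    using u_powr_step by metis
  obtain C6 where C6: "0 \<le> C6"
    "\<And>n0 n. (\<integral>\<^sup>+\<omega>. ennreal (N (X (Suc n) \<omega> - xs) powr p) \<partial>M)
      \<le> ennreal C6 * ((\<integral>\<^sup>+\<omega>. ennreal (norm (u n0 n \<omega>) powr p) \<partial>M) + (\<integral>\<^sup>+\<omega>. ennreal (N (w n0 n \<omega>) powr p) \<partial>M)
        + ennreal (\<eta> n powr p))"
    using X_moment_decomp by metis
  define \<alpha> where "\<alpha> = (1 - \<gamma>) * c"
  have \<alpha>: "0 < \<alpha>" "\<alpha> \<le> c" using \<gamma> c by (auto simp: \<alpha>_def algebra_simps)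
  \<comment> \<open>The weighted moment of \<open>u\<close> decays at rate \<open>A * c / 2\<close>.
    This choice reserves half of that, \<open>A * c / 4\<close>, for the coupling \<open>C4\<close>
    into \<open>w\<close>.\<close>
  define A where "A = 4 * C4 / c + 1"
  have A: "0 < A" "C4 \<le> A * c / 4" using C4 c by (auto simp: A_def field_simps intro: add_nonneg_pos)
  \<comment> \<open>What is left after all absorptions: for \<open>u\<close>, \<open>c / 2\<close>
    minus \<open>c / 4\<close> (coupling) minus \<open>c / 8\<close> (feedback); for
    \<open>w\<close>, \<open>\<alpha>\<close> minus \<open>\<alpha> / 2\<close> (feedback).\<close>
  define \<mu> where "\<mu> = min (c / 8) (\<alpha> / 2)"
  have \<mu>: "0 < \<mu>" "\<mu> \<le> c / 8" "\<mu> \<le> \<alpha> / 2" using c \<alpha> by (auto simp: \<mu>_def)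
  define \<tau> where "\<tau> = min (A * c / 8) (\<alpha> / 2)"
  have \<tau>: "0 < \<tau>" "\<tau> \<le> A * c / 8" "\<tau> \<le> \<alpha> / 2" using A c \<alpha> by (auto simp: \<tau>_def)
  define L where "L = A * C5 * C6"
  have L: "0 \<le> L" using A C5 C6 by (simp add: L_def)
  define C where "C = A * C5 * (1 + C6) + C4"
  have C: "0 \<le> C" using A C4 C5 C6 by (simp add: C_def)
  \<comment> \<open>Below this threshold the feedback \<open>L * y powr (p / 2 + 1)\<close>, at most
    \<open>L * y^2\<close>, fits into the reserved share \<open>\<tau> * y\<close>, and
    \<open>c * y\<close> does not exceed 1.\<close>
  define \<theta> where "\<theta> = min (1 / c) (\<tau> / (L + 1))"
  have \<theta>: "0 < \<theta>" "c * \<theta> \<le> 1" "L * \<theta> \<le> \<tau>"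
  proof -
    show "0 < \<theta>" using c \<tau> L by (simp add: \<theta>_def)
    have "c * \<theta> \<le> c * (1 / c)" using c by (intro mult_left_mono) (auto simp: \<theta>_def)
    then show "c * \<theta> \<le> 1" using c by simp
    have "L * \<theta> \<le> (L + 1) * (\<tau> / (L + 1))" using L \<tau> c by (intro mult_mono) (auto simp: \<theta>_def)
    then show "L * \<theta> \<le> \<tau>" using L by simp
  qed
  show thesis
  proof
    show "0 < A" "0 < \<mu>" "0 \<le> C" "0 < \<theta>" by fact+
    fix n0 n :: nat and r :: real
    assume n: "n0 \<le> n" and y\<theta>: "\<eta> (Suc n) \<le> \<theta>"
      and st: "\<eta> (Suc n) \<le> \<eta> n" "\<eta> n \<le> 2 * \<eta> (Suc n)" "\<eta> n - \<eta> (Suc n) \<le> 4 * (\<eta> (Suc n))\<^sup>2"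
      and r: "0 \<le> r" and Z: "ennreal A * U_mom n0 n + W_mom n0 n \<le> ennreal r"
    define y where "y = \<eta> (Suc n)"
    have y: "0 < y" "y \<le> 1" "y \<le> \<theta>" using \<eta>_pos \<eta>_le_1 y\<theta> by (simp_all add: y_def)
    have cy: "c * y \<le> 1" using mult_left_mono[OF y(3), of c] c \<theta>(2) by linarith
    have \<alpha>y: "\<alpha> * y \<le> 1" using mult_right_mono[OF \<alpha>(2), of y] cy y by linarith
    define yq where "yq = y powr (p / 2 + 1)"
    have yq0: "0 \<le> yq" by (simp add: yq_def)
    have Lyq: "L * yq \<le> \<tau> * y"
    proof -
      have "yq \<le> y powr 2" unfolding yq_def using y p by (intro powr_mono') auto
      also have "\<dots> = y * y" using y by (simp add: power2_eq_square)
      finally have "L * yq \<le> (L * y) * y" using L by (simp add: mult_left_mono mult.assoc)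
      also have "\<dots> \<le> \<tau> * y"
        using mult_left_mono[OF y(3), of L] L \<theta>(3) y by (intro mult_right_mono) auto
      finally show ?thesis .
    qed
    have "ennreal A * U_mom n0 n < \<infinity>" "W_mom n0 n < \<infinity>"
      using Z by (auto simp: less_top[symmetric] top_unique)
    then obtain Ur Wr where Ur: "U_mom n0 n = ennreal Ur" "0 \<le> Ur" and Wr: "W_mom n0 n = ennreal Wr" "0 \<le> Wr"
      using A by (cases "U_mom n0 n"; cases "W_mom n0 n") (auto simp: ennreal_mult_top)
    have rZ: "A * Ur + Wr \<le> r"
      using Z A Ur(2) Wr(2) r unfolding Ur(1) Wr(1) by (simp flip: ennreal_mult ennreal_plus)
    have E: "(\<integral>\<^sup>+\<omega>. ennreal (N (X (Suc n) \<omega> - xs) powr p) \<partial>M) \<le> ennreal (C6 * (Ur + Wr + 1))"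
    proof -
      have "\<eta> n powr p \<le> 1" using \<eta>_le_1[of n] \<eta>_pos[of n] p powr_le1[of p "\<eta> n"] by auto
      then have "ennreal C6 * (U_mom n0 n + W_mom n0 n + ennreal (\<eta> n powr p)) \<le> ennreal C6 * (ennreal Ur + ennreal Wr + ennreal 1)"
        unfolding Ur(1) Wr(1) by (intro mult_left_mono add_left_mono ennreal_leI) auto
      also have "\<dots> = ennreal (C6 * (Ur + Wr + 1))"
        using C6(1) Ur(2) Wr(2) by (simp flip: ennreal_mult ennreal_plus ennreal_1)
      finally show ?thesis using C6(2)[of n n0] unfolding U_mom_def W_mom_def by (rule order_trans[rotated])
    qed
    have U': "U_mom n0 (Suc n) \<le> ennreal ((1 - c / 2 * y) * Ur + C5 * yq * (1 + C6 * (Ur + Wr + 1)))"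
    proof -
      have "U_mom n0 (Suc n) \<le> ennreal (1 - c / 2 * y) * ennreal Ur
          + ennreal (C5 * yq) * (1 + (\<integral>\<^sup>+\<omega>. ennreal (N (X (Suc n) \<omega> - xs) powr p) \<partial>M))"
        using C5(2)[OF n] cy unfolding Ur(1)[symmetric] unfolding U_mom_def yq_def y_def by blast
      also have "\<dots> \<le> ennreal (1 - c / 2 * y) * ennreal Ur + ennreal (C5 * yq) * (1 + ennreal (C6 * (Ur + Wr + 1)))"
        by (intro add_left_mono mult_left_mono E) auto
      also have "\<dots> = ennreal ((1 - c / 2 * y) * Ur + C5 * yq * (1 + C6 * (Ur + Wr + 1)))"
        using C5(1) C6(1) Ur(2) Wr(2) yq0 cy by (simp flip: ennreal_mult ennreal_plus ennreal_1)
      finally show ?thesis .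
    qed
    have W': "W_mom n0 (Suc n) \<le> ennreal ((1 - \<alpha> * y) * Wr + C4 * y * Ur + C4 * yq)"
    proof -
      have "W_mom n0 (Suc n) \<le> (\<integral>\<^sup>+\<omega>. (ennreal (1 - \<alpha> * y) * ennreal (N (w n0 n \<omega>) powr p)
          + ennreal (C4 * y) * ennreal (norm (u n0 n \<omega>) powr p)) + ennreal (C4 * yq) \<partial>M)"
        unfolding W_mom_def
      proof (rule nn_integral_mono)
        fix \<omega>
        have "N (w n0 (Suc n) \<omega>) powr p \<le> (1 - \<alpha> * y) * N (w n0 n \<omega>) powr p + C4 * y * norm (u n0 n \<omega>) powr p + C4 * yq"
          using C4(2)[OF n _ st, of \<omega>] cy unfolding y_def yq_def \<alpha>_def by blast
        then show "ennreal (N (w n0 (Suc n) \<omega>) powr p) \<le> (ennreal (1 - \<alpha> * y) * ennreal (N (w n0 n \<omega>) powr p)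
          + ennreal (C4 * y) * ennreal (norm (u n0 n \<omega>) powr p)) + ennreal (C4 * yq)"
          using \<alpha>y C4(1) y yq0 by (simp flip: ennreal_mult ennreal_plus add: ennreal_leI)
      qed
      also have "\<dots> = (ennreal (1 - \<alpha> * y) * W_mom n0 n + ennreal (C4 * y) * U_mom n0 n) + ennreal (C4 * yq)"
        by (simp add: nn_integral_add nn_integral_cmult emeasure_space_1 W_mom_def U_mom_def)
      also have "\<dots> = ennreal ((1 - \<alpha> * y) * Wr + C4 * y * Ur + C4 * yq)"
        unfolding Ur(1) Wr(1) using \<alpha>y C4(1) y yq0 Ur(2) Wr(2) by (simp flip: ennreal_mult ennreal_plus)
      finally show ?thesis .
    qed
    let ?a = "(1 - c / 2 * y) * Ur + C5 * yq * (1 + C6 * (Ur + Wr + 1))"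
    let ?b = "(1 - \<alpha> * y) * Wr + C4 * y * Ur + C4 * yq"
    have "ennreal A * U_mom n0 (Suc n) + W_mom n0 (Suc n) \<le> ennreal A * ennreal ?a + ennreal ?b"
      by (intro add_mono mult_left_mono U' W') simp
    also have "\<dots> = ennreal (A * ?a + ?b)"
      using A cy \<alpha>y y yq0 C4(1) C5(1) C6(1) Ur(2) Wr(2) by (simp flip: ennreal_mult ennreal_plus)
    also have "\<dots> \<le> ennreal ((1 - \<mu> * y) * r + C * yq)"
    proof (rule ennreal_leI)
      have 1: "C4 * y * Ur \<le> A * c / 4 * y * Ur" using A y Ur(2) by (intro mult_right_mono) auto
      have 2: "L * yq * Ur \<le> A * c / 8 * y * Ur"
      proof -
        have "L * yq \<le> A * c / 8 * y" using Lyq mult_right_mono[OF \<tau>(2), of y] y by linarith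
        then show ?thesis using Ur(2) by (intro mult_right_mono)
      qed
      have 3: "L * yq * Wr \<le> \<alpha> / 2 * y * Wr"
      proof -
        have "L * yq \<le> \<alpha> / 2 * y" using Lyq mult_right_mono[OF \<tau>(3), of y] y by linarith
        then show ?thesis using Wr(2) by (intro mult_right_mono)
      qed
      have "A * ?a + ?b = A * Ur + Wr - A * c / 2 * y * Ur - \<alpha> * y * Wr + C4 * y * Ur
          + L * yq * Ur + L * yq * Wr + C * yq"
        by (simp add: L_def C_def algebra_simps)
      also have "\<dots> \<le> A * Ur + Wr - A * c / 8 * y * Ur - \<alpha> / 2 * y * Wr + C * yq"
        using 1 2 3 by (simp add: field_simps)
      also have "\<dots> = A * Ur + Wr - c / 8 * (A * y * Ur) - \<alpha> / 2 * (y * Wr) + C * yq" by (simp add: algebra_simps)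
      also have "\<dots> \<le> A * Ur + Wr - \<mu> * (A * y * Ur) - \<mu> * (y * Wr) + C * yq"
        using A y Ur(2) Wr(2) \<mu> by (intro add_right_mono diff_mono mult_right_mono order_refl) auto
      also have "\<dots> = (1 - \<mu> * y) * (A * Ur + Wr) + C * yq" by (simp add: algebra_simps)
      also have "\<dots> \<le> (1 - \<mu> * y) * r + C * yq"
      proof (intro add_right_mono mult_left_mono rZ)
        have "\<mu> * y \<le> \<alpha> * y" using \<mu>(3) \<alpha>(1) y by (intro mult_right_mono) auto
        then show "0 \<le> 1 - \<mu> * y" using \<alpha>y by linarith
      qed
      finally show "A * ?a + ?b \<le> (1 - \<mu> * y) * r + C * yq" .
    qed
    finally show "ennreal A * U_mom n0 (Suc n) + W_mom n0 (Suc n)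
        \<le> ennreal ((1 - \<mu> * \<eta> (Suc n)) * r + C * \<eta> (Suc n) powr (p / 2 + 1))"
      unfolding y_def yq_def .
  qed
qed

lemma W_mom_finite: "W_mom n n < \<infinity>"
proof -
  obtain A B where B: "0 < B" "\<And>x. N x \<le> B * norm x" using is_norm_equiv[OF norm] by metis
  have le: "N (w n n \<omega>) \<le> N (X (Suc n) \<omega> - xs) + B * D" for \<omega>
  proof -
    have "N (w n n \<omega>) \<le> N (X (Suc n) \<omega> - xs) + \<eta> n * N (h (\<xi> n \<omega>))"
      using N_triangle_diff[of "X (Suc n) \<omega> - xs" "\<eta> n *\<^sub>R h (\<xi> n \<omega>)"] \<eta>_pos[of n]
      by (simp add: w_def u_start N_scaleR del: sa_iter.simps)
    also have "\<dots> \<le> N (X (Suc n) \<omega> - xs) + 1 * (B * D)"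
      using \<eta>_pos[of n] \<eta>_le_1[of n] order_trans[OF B(2) mult_left_mono[OF h_bound, of B]] B(1)
      by (intro add_left_mono mult_mono) auto
    finally show ?thesis by simp
  qed
  have "W_mom n n \<le> (\<integral>\<^sup>+\<omega>. ennreal ((N (X (Suc n) \<omega> - xs) + B * D) powr p) \<partial>M)"
    unfolding W_mom_def using p le by (intro nn_integral_mono ennreal_leI powr_mono2) auto
  also have "\<dots> \<le> ennreal (2 powr p) * ((\<integral>\<^sup>+\<omega>. ennreal (N (X (Suc n) \<omega> - xs) powr p) \<partial>M) + (\<integral>\<^sup>+\<omega>. ennreal ((B * D) powr p) \<partial>M))"
    using p B(1) D_nonneg by (intro nn_integral_powr_add_le) (auto simp del: sa_iter.simps)
  also have "\<dots> < \<infinity>"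
    using X_moment_finite[of "Suc n"] by (simp add: ennreal_mult_less_top emeasure_space_1 del: sa_iter.simps)
  finally show ?thesis .
qed

text \<open>From some \<open>n0\<close> on, the regularity of the step sizes makes
  \<open>B * \<eta> n powr (p / 2)\<close> an invariant bound for the weighted moment; times up to
  \<open>n0\<close> are covered by enlarging the constant.\<close>

lemma X_moment_bound:
  assumes dec: "decseq \<eta>" and lim: "\<eta> \<longlonglongrightarrow> 0"
    and A5_ii: "(\<lambda>t. (\<eta> t - \<eta> (Suc t)) / \<eta> t) \<in> o(\<lambda>t. \<eta> t)"
  obtains C where "0 \<le> C"
    "\<And>t. (\<integral>\<^sup>+\<omega>. ennreal (N (X t \<omega> - xs) powr p) \<partial>M) \<le> ennreal (C * \<eta> t powr (p / 2))"
proof -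
  obtain A \<mu> C \<theta> where A: "0 < A" and \<mu>: "0 < \<mu>" and C: "0 \<le> C" and \<theta>: "0 < \<theta>"
    and drift: "\<And>n0 n r. \<lbrakk>n0 \<le> n; \<eta> (Suc n) \<le> \<theta>; \<eta> (Suc n) \<le> \<eta> n; \<eta> n \<le> 2 * \<eta> (Suc n);
        \<eta> n - \<eta> (Suc n) \<le> 4 * (\<eta> (Suc n))\<^sup>2; 0 \<le> r; ennreal A * U_mom n0 n + W_mom n0 n \<le> ennreal r\<rbrakk> \<Longrightarrow>
      ennreal A * U_mom n0 (Suc n) + W_mom n0 (Suc n)
        \<le> ennreal ((1 - \<mu> * \<eta> (Suc n)) * r + C * \<eta> (Suc n) powr (p / 2 + 1))"
    using drift by metis
  define q where "q = p / 2"
  have q: "1 \<le> q" "q \<le> p" using p by (auto simp: q_def)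
  \<comment> \<open>The bound 1/2 makes consecutive steps comparable within a factor 2; the other
    entry makes the step sizes decrease slowly compared with the rate \<open>\<mu>\<close>.\<close>
  define \<delta> where "\<delta> = min (1 / 2) (\<mu> / (4 * q))"
  have \<delta>: "0 < \<delta>" "\<delta> \<le> 1 / 2" "4 * q * \<delta> \<le> \<mu>"
  proof -
    show "0 < \<delta>" "\<delta> \<le> 1 / 2" using \<mu> q by (auto simp: \<delta>_def)
    have "4 * q * \<delta> \<le> 4 * q * (\<mu> / (4 * q))" using q by (intro mult_left_mono) (auto simp: \<delta>_def)
    then show "4 * q * \<delta> \<le> \<mu>" using q by simp
  qed
  have "eventually (\<lambda>n. norm ((\<eta> n - \<eta> (Suc n)) / \<eta> n) \<le> \<delta> * norm (\<eta> n)) sequentially"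
    using landau_o.smallD[OF A5_ii \<delta>(1)] by simp
  moreover have "eventually (\<lambda>n. \<eta> n < \<theta>) sequentially" using lim \<theta> by (rule order_tendstoD)
  ultimately have "eventually (\<lambda>n. norm ((\<eta> n - \<eta> (Suc n)) / \<eta> n) \<le> \<delta> * norm (\<eta> n) \<and> \<eta> n < \<theta>) sequentially"
    by eventually_elim auto
  then obtain n0 where n0: "\<And>n. n0 \<le> n \<Longrightarrow> norm ((\<eta> n - \<eta> (Suc n)) / \<eta> n) \<le> \<delta> * norm (\<eta> n)"
    "\<And>n. n0 \<le> n \<Longrightarrow> \<eta> n < \<theta>"
    unfolding eventually_sequentially by auto
  have dec': "\<eta> (Suc n) \<le> \<eta> n" for n using dec by (simp add: decseq_SucD)
  have d1: "\<eta> n - \<eta> (Suc n) \<le> \<delta> * (\<eta> n)\<^sup>2" if "n0 \<le> n" for n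
    using n0(1)[OF that] dec'[of n] \<eta>_pos[of n] by (simp add: abs_div field_simps power2_eq_square)
  have d2: "\<eta> n \<le> 2 * \<eta> (Suc n)" if "n0 \<le> n" for n
  proof -
    have "\<delta> * (\<eta> n)\<^sup>2 \<le> 1 / 2 * (\<eta> n * 1)"
      unfolding power2_eq_square using \<delta> \<eta>_pos[of n] \<eta>_le_1[of n] by (intro mult_mono mult_left_mono) auto
    then show ?thesis using d1[OF that] by simp
  qed
  have d3: "\<eta> n - \<eta> (Suc n) \<le> 4 * (\<eta> (Suc n))\<^sup>2" if "n0 \<le> n" for n
  proof -
    have "\<delta> * (\<eta> n)\<^sup>2 \<le> 1 * (2 * \<eta> (Suc n))\<^sup>2"
      using \<delta> \<eta>_pos[of n] d2[OF that] by (intro mult_mono power_mono) auto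
    then show ?thesis using d1[OF that] by (simp add: power_mult_distrib)
  qed
  obtain W0 where W0: "W_mom n0 n0 = ennreal W0" "0 \<le> W0"
    using W_mom_finite[of n0] by (cases "W_mom n0 n0") auto
  have U0: "U_mom n0 n0 = 0" by (simp add: U_mom_def u_start)
  \<comment> \<open>The first entry absorbs the forcing term in each step, the second covers the
    initial moment of \<open>w\<close> at \<open>n0\<close>, where \<open>u\<close>
    vanishes.\<close>
  define B where "B = max (2 * C / \<mu>) (W0 / \<eta> n0 powr q)"
  have B0: "0 \<le> B" "2 * C \<le> \<mu> * B" "W0 \<le> B * \<eta> n0 powr q"
  proof -
    show "0 \<le> B" using C \<mu> by (auto simp: B_def le_max_iff_disj)
    have "\<mu> * (2 * C / \<mu>) \<le> \<mu> * B" using \<mu> by (intro mult_left_mono) (auto simp: B_def)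
    then show "2 * C \<le> \<mu> * B" using \<mu> by simp
    have "W0 / \<eta> n0 powr q * \<eta> n0 powr q \<le> B * \<eta> n0 powr q" by (intro mult_right_mono) (auto simp: B_def)
    then show "W0 \<le> B * \<eta> n0 powr q" using \<eta>_pos[of n0] by simp
  qed
  have Z: "ennreal A * U_mom n0 n + W_mom n0 n \<le> ennreal (B * \<eta> n powr q)" if "n0 \<le> n" for n
    using that
  proof (induction n rule: dec_induct)
    case base
    show ?case using B0(3) by (simp add: U0 W0 ennreal_leI)
  next
    case (step n)
    have "ennreal A * U_mom n0 (Suc n) + W_mom n0 (Suc n)
        \<le> ennreal ((1 - \<mu> * \<eta> (Suc n)) * (B * \<eta> n powr q) + C * \<eta> (Suc n) powr (p / 2 + 1))"
      using step n0(2)[of "Suc n"] dec' d2 d3 B0(1) by (intro drift) auto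
    also have "\<dots> \<le> ennreal (B * \<eta> (Suc n) powr q)"
      unfolding q_def[symmetric] using step d1 d2 dec' q \<delta> B0 C \<eta>_pos
      by (intro ennreal_leI step_size_recursion[where \<delta>=\<delta>]) auto
    finally show ?case .
  qed
  obtain C6 where C6: "0 \<le> C6"
    "\<And>n0 n. (\<integral>\<^sup>+\<omega>. ennreal (N (X (Suc n) \<omega> - xs) powr p) \<partial>M)
      \<le> ennreal C6 * ((\<integral>\<^sup>+\<omega>. ennreal (norm (u n0 n \<omega>) powr p) \<partial>M) + (\<integral>\<^sup>+\<omega>. ennreal (N (w n0 n \<omega>) powr p) \<partial>M)
        + ennreal (\<eta> n powr p))"
    using X_moment_decomp by metis
  \<comment> \<open>\<open>B / A\<close> and \<open>B\<close> bound the moments of \<open>u\<close>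
    and \<open>w\<close>, 1 covers the correction by \<open>h\<close>, and \<open>2 powr q\<close>
    pays for passing from \<open>\<eta> n\<close> to \<open>\<eta> (Suc n)\<close>.\<close>
  define E1 where "E1 = C6 * (B / A + B + 1) * 2 powr q"
  have E1: "(\<integral>\<^sup>+\<omega>. ennreal (N (X (Suc n) \<omega> - xs) powr p) \<partial>M) \<le> ennreal (E1 * \<eta> (Suc n) powr q)" if n: "n0 \<le> n" for n
  proof -
    let ?x = "\<eta> n powr q"
    have "W_mom n0 n \<le> ennreal (B * ?x)" using Z[OF n] by (rule order_trans[rotated]) simp
    moreover have "U_mom n0 n \<le> ennreal (B / A * ?x)"
    proof -
      have "U_mom n0 n = ennreal (1 / A) * (ennreal A * U_mom n0 n)"
        using A by (simp add: mult.assoc[symmetric] ennreal_mult[symmetric])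
      also have "\<dots> \<le> ennreal (1 / A) * ennreal (B * ?x)"
        using Z[OF n] by (intro mult_left_mono) (auto intro: order_trans[rotated])
      also have "\<dots> = ennreal (B / A * ?x)" using A B0 by (simp add: ennreal_mult[symmetric])
      finally show ?thesis .
    qed
    moreover have "\<eta> n powr p \<le> ?x" using \<eta>_pos[of n] \<eta>_le_1[of n] q by (intro powr_mono') auto
    ultimately have "ennreal C6 * (U_mom n0 n + W_mom n0 n + ennreal (\<eta> n powr p))
        \<le> ennreal C6 * (ennreal (B / A * ?x) + ennreal (B * ?x) + ennreal ?x)"
      by (intro mult_left_mono add_mono ennreal_leI) auto
    also have "\<dots> = ennreal (C6 * (B / A + B + 1) * ?x)"
      using C6(1) A B0 by (simp add: algebra_simps flip: ennreal_mult ennreal_plus)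
    also have "\<dots> \<le> ennreal (E1 * \<eta> (Suc n) powr q)"
    proof (rule ennreal_leI)
      have "?x \<le> (2 * \<eta> (Suc n)) powr q" using d2[OF n] \<eta>_pos[of n] q by (intro powr_mono2) auto
      also have "\<dots> = 2 powr q * \<eta> (Suc n) powr q" using \<eta>_pos[of "Suc n"] by (simp add: powr_mult)
      finally have "C6 * (B / A + B + 1) * ?x \<le> C6 * (B / A + B + 1) * (2 powr q * \<eta> (Suc n) powr q)"
        using C6 A B0 by (intro mult_left_mono) auto
      then show "C6 * (B / A + B + 1) * ?x \<le> E1 * \<eta> (Suc n) powr q" by (simp add: E1_def)
    qed
    finally show ?thesis using C6(2)[of n n0] unfolding U_mom_def W_mom_def by (rule order_trans[rotated])
  qed
  define F where "F t = enn2real (\<integral>\<^sup>+\<omega>. ennreal (N (X t \<omega> - xs) powr p) \<partial>M)" for t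
  have F: "(\<integral>\<^sup>+\<omega>. ennreal (N (X t \<omega> - xs) powr p) \<partial>M) = ennreal (F t)" "0 \<le> F t" for t
    using X_moment_finite[of t] by (auto simp: F_def less_top)
  \<comment> \<open>A finite sum of nonnegative ratios, so it dominates each of them.\<close>
  define E2 where "E2 = (\<Sum>t\<le>n0. F t / \<eta> t powr q)"
  have E2: "F t \<le> E2 * \<eta> t powr q" if "t \<le> n0" for t
  proof -
    have "F t / \<eta> t powr q \<le> E2" unfolding E2_def
      using that F(2) by (intro member_le_sum) auto
    then show ?thesis using \<eta>_pos[of t] by (simp add: field_simps)
  qed
  have E10: "0 \<le> E1" and E20: "0 \<le> E2"
    using C6(1) A B0(1) F(2) by (auto simp: E1_def E2_def intro!: sum_nonneg)
  show thesis
  proof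
    show "0 \<le> E1 + E2" using E10 E20 by simp
    fix t
    show "(\<integral>\<^sup>+\<omega>. ennreal (N (X t \<omega> - xs) powr p) \<partial>M) \<le> ennreal ((E1 + E2) * \<eta> t powr (p / 2))"
    proof (cases "t \<le> n0")
      case True
      then show ?thesis unfolding F(1) q_def[symmetric]
        using E2[OF True] E10 by (intro ennreal_leI) (simp add: distrib_right add_increasing)
    next
      case False
      then obtain n where t: "t = Suc n" "n0 \<le> n" by (cases t) auto
      have "(\<integral>\<^sup>+\<omega>. ennreal (N (X (Suc n) \<omega> - xs) powr p) \<partial>M) \<le> ennreal (E1 * \<eta> (Suc n) powr q)" by (rule E1[OF t(2)])
      also have "\<dots> \<le> ennreal ((E1 + E2) * \<eta> (Suc n) powr q)" using E20 by (intro ennreal_leI mult_right_mono) auto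
      finally show ?thesis unfolding t(1) q_def .
    qed
  qed
qed

end

theorem theorem2:
  fixes M :: "'w measure"
    and \<xi> :: "nat \<Rightarrow> 'w \<Rightarrow> 'a::polish_space"
    and K :: "'a \<Rightarrow> 'a measure"
    and \<pi> :: "'a measure"
    and N :: "'b::euclidean_space \<Rightarrow> real"
    and H :: "'b \<Rightarrow> 'a \<Rightarrow> 'b"
    and \<eta> :: "nat \<Rightarrow> real"
    and xs x0 :: 'b
    and p \<sigma> L\<^sub>H \<kappa> \<rho> :: real
  assumes chain: "markov_chain M \<xi> K"
    and stat: "stationary K \<pi>"
    and norm: "is_norm N"
    and H_meas: "(\<lambda>(x, z). H x z) \<in> borel_measurable (borel \<Otimes>\<^sub>M borel)"
    and H_intK: "\<And>x z. integrable (K z) (H x)"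
    and H_intpi: "\<And>x. integrable \<pi> (H x)"
    and root: "(\<integral>z. H xs z \<partial>\<pi>) = 0"
    \<comment> \<open>(A2)\<close>
    and p_gt: "p > 2" and sigma_pos: "\<sigma> > 0"
    and A2_mom: "\<exists>B. \<forall>t. (\<integral>\<^sup>+ \<omega>. ennreal (N (H xs (\<xi> t \<omega>)) powr p) \<partial>M) \<le> ennreal B"
    and A2_sig: "\<And>z. N (\<integral>z'. H xs z' \<partial>K z) \<le> \<sigma>"
    \<comment> \<open>(A3)\<close>
    and A3: "\<And>x y z. (\<integral>\<^sup>+ z'. ennreal (N (H x z' - H y z') powr p) \<partial>K z)
                      \<le> ennreal ((L\<^sub>H * N (x - y)) powr p)"
    \<comment> \<open>(A4)\<close>
    and A4_uniq: "\<And>\<pi>'. stationary K \<pi>' \<Longrightarrow> \<pi>' = \<pi>"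
    and kappa: "\<kappa> \<ge> exp 1" and rho: "0 \<le> \<rho>" "\<rho> < 1"
    and A4_mix: "\<And>z t. dtv (kpow K t z) \<pi> \<le> \<kappa> * \<rho> ^ t / 2"
    \<comment> \<open>(A5)\<close>
    and A5_pos: "\<And>t. 0 < \<eta> t \<and> \<eta> t \<le> 1"
    and A5_dec: "decseq \<eta>" and A5_lim: "\<eta> \<longlonglongrightarrow> 0"
    and A5_log: "(\<lambda>t. \<eta> t * (ln (real t))\<^sup>2) \<longlonglongrightarrow> 0"
    and A5_teta_mono: "mono (\<lambda>t. real t * \<eta> t)"
    and A5_teta_inf: "filterlim (\<lambda>t. real t * \<eta> t) at_top sequentially"
    and A5_ii: "(\<lambda>t. (\<eta> t - \<eta> (Suc t)) / \<eta> t) \<in> o(\<lambda>t. \<eta> t)"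
    and A5_iii: "summable (\<lambda>t. ln (real (Suc t)) / sqrt (real (Suc t)) * \<eta> (Suc t))"
    and A5_iv: "\<exists>C. \<forall>T\<ge>1. (\<Sum>t=0..T. \<eta> t) / (real T * \<eta> T) \<le> C"
    \<comment> \<open>(A7)\<close>
    and A7: "\<exists>\<gamma> c. 0 \<le> \<gamma> \<and> \<gamma> < 1 \<and> c > 0 \<and>
              (\<forall>x y z. N ((\<integral>z'. H x z' - H y z' \<partial>K z) - c *\<^sub>R (x - y)) \<le> \<gamma> * c * N (x - y))"
    \<comment> \<open>(A8)\<close>
    and A8: "\<exists>Mc g. Mc > 0 \<and> g \<in> borel_measurable borel \<and> (\<forall>z. g z \<ge> 0) \<and>
              (\<forall>x z. N (H x z) \<le> Mc * (N x + g z)) \<and>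
              (\<exists>B. \<forall>t. (\<integral>\<^sup>+ \<omega>. ennreal (\<bar>g (\<xi> t \<omega>)\<bar> powr p) \<partial>M) \<le> ennreal B)"
  shows "\<exists>Cp\<ge>1. \<forall>t.
           (\<integral>\<^sup>+ \<omega>. ennreal (N (sa_iter H \<eta> \<xi> x0 t \<omega> - xs) powr p) \<partial>M)
             \<le> ennreal ((Cp * max (a_seq \<rho> \<sigma> \<kappa> \<eta> t) 1 * sqrt (\<eta> t)) powr p)"
proof -
  have K: "K \<in> borel \<rightarrow>\<^sub>M prob_algebra borel" using chain by (simp add: markov_chain_def)
  have \<pi>: "prob_space \<pi>" "sets \<pi> = sets borel" using stat by (auto simp: stationary_def)
  interpret \<pi>: prob_space \<pi> by (rule \<pi>)
  obtain \<gamma> c where A7': "0 \<le> \<gamma>" "\<gamma> < 1" "c > 0"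
    "\<And>x y z. N ((\<integral>z'. H x z' - H y z' \<partial>K z) - c *\<^sub>R (x - y)) \<le> \<gamma> * c * N (x - y)"
    using A7 by blast
  obtain Mc g G where A8': "Mc > 0" "g \<in> borel_measurable borel" "\<And>z. g z \<ge> 0"
    "\<And>x z. N (H x z) \<le> Mc * (N x + g z)"
    "\<And>t. (\<integral>\<^sup>+ \<omega>. ennreal (\<bar>g (\<xi> t \<omega>)\<bar> powr p) \<partial>M) \<le> ennreal G"
    using A8 by blast
  obtain A B where A: "0 < A" "\<And>x. norm x \<le> A * N x" using is_norm_equiv[OF norm] by metis
  define b where "b z = (\<integral>z'. H xs z' \<partial>K z)" for z
  have Hxs[measurable]: "H xs \<in> borel_measurable borel"
    using measurable_compose[OF measurable_Pair1'[of xs borel borel] H_meas] by simp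
  have b_meas[measurable]: "b \<in> borel_measurable borel"
    unfolding b_def by (rule measurable_compose[OF measurable_prob_algebraD[OF K]]) simp
  have b_bound: "norm (b z) \<le> A * \<sigma>" for z
    unfolding b_def using order_trans[OF A(2) mult_left_mono[OF A2_sig]] A(1) by simp
  have b_int: "integrable \<pi> b"
    using b_bound \<pi>(2) by (intro \<pi>.integrable_const_bound[where B="A * \<sigma>"]) (auto simp: measurable_cong_sets[OF \<pi>(2) refl])
  \<comment> \<open>Stationarity removes the transition: the mean of \<open>b\<close> under
    \<open>\<pi>\<close> is that of \<open>H xs\<close>, which vanishes because \<open>xs\<close> is
    a root.\<close>
  have b_mean: "(\<integral>z. b z \<partial>\<pi>) = 0"
    using stationary_integral[OF K stat Hxs H_intK H_intpi] b_int root unfolding b_def by simp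
  obtain h D where h: "h \<in> borel_measurable borel" "\<And>z. norm (h z) \<le> D"
    "\<And>z. (\<integral>z'. h z' \<partial>K z) = h z - b z"
    using poisson_equation[OF K \<pi> b_meas b_bound b_mean rho A4_mix] by metis
  interpret sa_markov M \<xi> K N H \<eta> xs x0 p c \<gamma> Mc G D g h
    using chain norm H_meas H_intK p_gt A7' A8' A5_pos h by unfold_locales (auto simp: b_def)
  obtain C where C: "0 \<le> C"
    "\<And>t. (\<integral>\<^sup>+\<omega>. ennreal (N (sa_iter H \<eta> \<xi> x0 t \<omega> - xs) powr p) \<partial>M) \<le> ennreal (C * \<eta> t powr (p / 2))"
    using X_moment_bound[OF A5_dec A5_lim A5_ii] by metis
  define Cp where "Cp = max 1 (C powr (1 / p))"
  have "(\<integral>\<^sup>+ \<omega>. ennreal (N (sa_iter H \<eta> \<xi> x0 t \<omega> - xs) powr p) \<partial>M)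
      \<le> ennreal ((Cp * max (a_seq \<rho> \<sigma> \<kappa> \<eta> t) 1 * sqrt (\<eta> t)) powr p)" for t
  proof (rule order_trans[OF C(2)], rule ennreal_leI)
    have "C * \<eta> t powr (p / 2) = (C powr (1 / p) * 1 * sqrt (\<eta> t)) powr p"
      using C(1) A5_pos[of t] p_gt by (simp add: powr_mult powr_powr powr_half_sqrt[symmetric])
    \<comment> \<open>The factor \<open>max (a_seq \<rho> \<sigma> \<kappa> \<eta> t) 1\<close> is
      at least 1, whatever the value of \<open>a_seq\<close>, so it can only enlarge the right-hand
      side.\<close>
    also have "\<dots> \<le> (Cp * max (a_seq \<rho> \<sigma> \<kappa> \<eta> t) 1 * sqrt (\<eta> t)) powr p"
      using p_gt A5_pos[of t] by (intro powr_mono2 mult_mono) (auto simp: Cp_def)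
    finally show "C * \<eta> t powr (p / 2) \<le> (Cp * max (a_seq \<rho> \<sigma> \<kappa> \<eta> t) 1 * sqrt (\<eta> t)) powr p" .
  qed
  then show ?thesis by (intro exI[of _ Cp]) (auto simp: Cp_def)
qed

end
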